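(* Assume $\alpha > 0$. Let $\mathcal{W}_n=\max\{W[n,j] : -(N-1)\le j\le n\}$ be the maximum of the weights of the vertices after $n$ steps of the $N$-interactions model, and let $\mu=\sup\{\gamma_j : j\ge -(N-1)\}$. Then $\mu$ is a finite positive random variable (almost surely), and $$\mathcal{W}_n \sim \frac{1}{\Gamma(1+\alpha)}\,\mu\, n^{\alpha}\qquad\text{almost surely as } n\to\infty .$$
   Context: The $N$-interactions model. Fix an integer $N\ge 3$ and parameters $0<p\le 1$, $q,r\in[0,1]$. An $m$-clique is a complete graph on $m$ vertices, $K_m$. At time $n=0$ the graph is a single $K_N$; this graph and all of its cliques (in particular its vertices, its $(N-1)$-cliques and the $N$-clique itself) have initial weight $1$. At each step $n=1,2,\dots$ a set of $N$ vertices interacts: all non-existing edges between them are drawn, so that they form a $K_N$, and the weights of this $K_N$ and of all cliques contained in it are increased by $1$ (a clique that was never contained in the initial or an interacting $K_N$ has weight $0$). The $N$ interacting vertices are chosen, given the past, as follows. - With probability $p$ a new vertex is added, and it interacts with $N-1$ old vertices. With probability $r$ these are the vertices of an $(N-1)$-clique chosen from the existing $(N-1)$-cliques with probability proportional to weight (a clique of weight $w_t$ is chosen with probability $w_t/\sum_h w_h$); with probability $1-r$ they are a uniformly chosen $(N-1)$-element subset of the existing vertices. - With probability $1-p$ no new vertex is added and $N$ old vertices interact. With probability $q$ these are the vertices of an $N$-clique chosen from the existing $N$-cliques with probability proportional to weight; with probability $1-q$ they are a uniformly chosen $N$-element subset of the existing vertices. Constants: $\alpha=(1-p)q+\frac{N-1}{N}pr$.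 Labels: the $N$ initial vertices are labelled $0,-1,\dots,-(N-1)$; new vertices are labelled $1,2,\dots$ in the order in which they are added. $W[n,j]$ is the weight of the vertex labelled $j$ after the $n$th step, with $W[n,j]=0$ if this vertex does not yet exist after $n$ steps. For $\alpha>0$ and each $j\ge-(N-1)$, $\gamma_j$ is the positive random variable with $W[n,j]\sim\frac{1}{\Gamma(1+\alpha)}\gamma_j n^{\alpha}$ almost surely, i.e. $\gamma_j=\Gamma(1+\alpha)\lim_{n\to\infty}n^{-\alpha}W[n,j]$, a limit that exists and is positive almost surely. $\Gamma$ is the Gamma function. *)

theory Defs
  imports "HOL-Probability.Probability" "HOL-Library.Landau_Symbols"
begin

text \<open>Simple graphs on integer labels, with a weight attached to every clique.  An edge is a
  two-element set of vertices, and an m-clique is identified with its m-element vertex set;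
  in particular, the weight of a vertex \<open>j\<close> is the weight of \<open>{j}\<close>.\<close>

record wgraph =
  verts :: "int set"
  edges :: "int set set"
  weight :: "int set \<Rightarrow> nat"

definition complete_edges :: "int set \<Rightarrow> int set set" where
  "complete_edges S = {{u, v} | u v. u \<in> S \<and> v \<in> S \<and> u \<noteq> v}"

definition cliques :: "nat \<Rightarrow> wgraph \<Rightarrow> int set set" where
  "cliques m g = {C. C \<subseteq> verts g \<and> card C = m \<and> complete_edges C \<subseteq> edges g}"

definition initial_graph :: "nat \<Rightarrow> wgraph" where
  "initial_graph N = (let V = {- (int N - 1)..0} in
     \<lparr>verts = V, edges = complete_edges V,
      weight = (\<lambda>C. if C \<noteq> {} \<and> C \<subseteq> V then 1 else 0)\<rparr>)"

definition interact :: "int set \<Rightarrow> wgraph \<Rightarrow> wgraph" where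
  "interact S g =
     \<lparr>verts = verts g \<union> S, edges = edges g \<union> complete_edges S,
      weight = (\<lambda>C. if C \<noteq> {} \<and> C \<subseteq> S then weight g C + 1 else weight g C)\<rparr>"

text \<open>Choice from a finite set \<open>A\<close> with probability proportional to \<open>w\<close>; meaningful only if the
  total weight is positive, see \<open>pmf_weighted_pmf\<close> below.\<close>

definition weighted_pmf :: "'b set \<Rightarrow> ('b \<Rightarrow> nat) \<Rightarrow> 'b pmf" where
  "weighted_pmf A w =
     embed_pmf (\<lambda>x. if x \<in> A then real (w x) / (\<Sum>y\<in>A. real (w y)) else 0)"

lemma pmf_weighted_pmf:
  assumes "finite A" and "(\<Sum>y\<in>A. real (w y)) > 0"
  shows "pmf (weighted_pmf A w) x =
    (if x \<in> A then real (w x) / (\<Sum>y\<in>A. real (w y)) else 0)"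
  unfolding weighted_pmf_def
proof (rule pmf_embed_pmf)
  let ?f = "\<lambda>x. if x \<in> A then real (w x) / (\<Sum>y\<in>A. real (w y)) else 0"
  show "0 \<le> ?f x" for x
    by (simp add: sum_nonneg)
  have "(\<integral>\<^sup>+ x. ennreal (?f x) \<partial>count_space UNIV) = (\<integral>\<^sup>+ x. ennreal (?f x) \<partial>count_space A)"
    by (rule nn_integral_count_space_eq) auto
  also have "\<dots> = (\<Sum>x\<in>A. ennreal (?f x))"
    using assms(1) by (rule nn_integral_count_space_finite)
  also have "\<dots> = ennreal (\<Sum>x\<in>A. ?f x)"
    by (rule sum_ennreal) (simp add: sum_nonneg)
  also have "(\<Sum>x\<in>A. ?f x) = (\<Sum>x\<in>A. real (w x) / (\<Sum>y\<in>A. real (w y)))"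
    by (rule sum.cong) auto
  also have "\<dots> = 1"
    using assms(2) by (simp flip: sum_divide_distrib)
  finally show "(\<integral>\<^sup>+ x. ennreal (?f x) \<partial>count_space UNIV) = 1"
    by simp
qed

definition uniform_subset_pmf :: "nat \<Rightarrow> wgraph \<Rightarrow> int set pmf" where
  "uniform_subset_pmf m g = pmf_of_set {S. S \<subseteq> verts g \<and> card S = m}"

definition weighted_clique_pmf :: "nat \<Rightarrow> wgraph \<Rightarrow> int set pmf" where
  "weighted_clique_pmf m g = weighted_pmf (cliques m g) (weight g)"

text \<open>The initial graph has the \<open>N\<close> vertices \<open>-(N-1), \<dots>, 0\<close>, so this is the first
  of the labels \<open>1, 2, \<dots>\<close> not yet in use.\<close>

definition new_label :: "nat \<Rightarrow> wgraph \<Rightarrow> int" where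
  "new_label N g = int (card (verts g)) - int N + 1"

definition interacting_pmf :: "nat \<Rightarrow> real \<Rightarrow> real \<Rightarrow> real \<Rightarrow> wgraph \<Rightarrow> int set pmf" where
  "interacting_pmf N p q r g = do {
     new \<leftarrow> bernoulli_pmf p;
     if new then do {
       preferential \<leftarrow> bernoulli_pmf r;
       old \<leftarrow> (if preferential then weighted_clique_pmf (N - 1) g
              else uniform_subset_pmf (N - 1) g);
       return_pmf (insert (new_label N g) old)
     } else do {
       preferential \<leftarrow> bernoulli_pmf q;
       (if preferential then weighted_clique_pmf N g else uniform_subset_pmf N g)
     }
   }"

definition step_pmf :: "nat \<Rightarrow> real \<Rightarrow> real \<Rightarrow> real \<Rightarrow> wgraph \<Rightarrow> wgraph pmf" where
  "step_pmf N p q r g = map_pmf (\<lambda>S. interact S g) (interacting_pmf N p q r g)"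

text \<open>The last clause is the elementary form (conditioning on events of positive probability is
  multiplied out) of: given the past \<open>G 0, \<dots>, G n\<close>, the graph \<open>G (Suc n)\<close>
  has distribution \<open>step_pmf N p q r (G n)\<close>.\<close>

definition interactions_model ::
    "'a measure \<Rightarrow> nat \<Rightarrow> real \<Rightarrow> real \<Rightarrow> real \<Rightarrow> (nat \<Rightarrow> 'a \<Rightarrow> wgraph) \<Rightarrow> bool" where
  "interactions_model M N p q r G \<longleftrightarrow>
     prob_space M \<and>
     (\<forall>n. G n \<in> measurable M (count_space UNIV)) \<and>
     (AE \<omega> in M. G 0 \<omega> = initial_graph N) \<and>
     (\<forall>n g. measure M {\<omega> \<in> space M. \<forall>k\<le>Suc n. G k \<omega> = g k} =
            measure M {\<omega> \<in> space M. \<forall>k\<le>n. G k \<omega> = g k} *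
              pmf (step_pmf N p q r (g n)) (g (Suc n)))"

definition model_alpha :: "nat \<Rightarrow> real \<Rightarrow> real \<Rightarrow> real \<Rightarrow> real" where
  "model_alpha N p q r = (1 - p) * q + (real N - 1) / real N * p * r"

definition vertex_weight :: "(nat \<Rightarrow> 'a \<Rightarrow> wgraph) \<Rightarrow> nat \<Rightarrow> int \<Rightarrow> 'a \<Rightarrow> real" where
  "vertex_weight G n j \<omega> = real (weight (G n \<omega>) {j})"

definition max_weight :: "nat \<Rightarrow> (nat \<Rightarrow> 'a \<Rightarrow> wgraph) \<Rightarrow> nat \<Rightarrow> 'a \<Rightarrow> real" where
  "max_weight N G n \<omega> = Max ((\<lambda>j. vertex_weight G n j \<omega>) ` {- (int N - 1)..int n})"

text \<open>In the model the limit exists almost surely when \<open>\<alpha> > 0\<close>; the (unspecified) value of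
  \<open>lim\<close> is irrelevant on the remaining null set.\<close>

definition limit_gamma :: "(nat \<Rightarrow> 'a \<Rightarrow> wgraph) \<Rightarrow> real \<Rightarrow> int \<Rightarrow> 'a \<Rightarrow> real" where
  "limit_gamma G \<alpha> j \<omega> =
     Gamma (1 + \<alpha>) * lim (\<lambda>n. real n powr (- \<alpha>) * vertex_weight G n j \<omega>)"

text \<open>Taken in the extended reals, so that finiteness is not built in.\<close>

definition limit_mu :: "nat \<Rightarrow> (nat \<Rightarrow> 'a \<Rightarrow> wgraph) \<Rightarrow> real \<Rightarrow> 'a \<Rightarrow> ereal" where
  "limit_mu N G \<alpha> \<omega> = (SUP j\<in>{- (int N - 1)..}. ereal (limit_gamma G \<alpha> j \<omega>))"

end

theory Submission
  imports Defs "HOL-Real_Asymp.Real_Asymp"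
begin

text \<open>Put \<open>C n = (\<Prod>i<n. 1 + \<alpha> / (i + 1))\<close>, so that \<open>C n \<sim> n powr \<alpha> / Gamma (1 + \<alpha>)\<close>.
  Given the past, an existing vertex of weight \<open>w\<close> takes part in step \<open>m + 1\<close> with probability
  \<open>\<alpha> * w / (m + 1) + \<beta> / V\<close>, where \<open>V\<close> is the number of vertices, and almost surely
  \<open>V \<ge> c * (m + 1)\<close> eventually. As long as the latter holds, the participation probability lies
  between \<open>\<alpha> * w / (m + 1)\<close> and \<open>\<alpha> * (w + b) / (m + 1)\<close> with \<open>b = \<beta> / (\<alpha> * c)\<close>, so simple
  functions of \<open>w\<close> are supermartingales, and the maximal inequality for nonnegative
  supermartingales, stopped when \<open>V\<close> gets too small, suffices for everything.
  The rising factorials of \<open>w + b\<close> of high order show, by Borel-Cantelli, that \<open>w / C n\<close> is small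
  uniformly in \<open>n\<close> for all late vertices; the quadratic one yields a bound on the oscillation of
  \<open>(w + b) / C n\<close> and hence its convergence; a function of order \<open>1 / sqrt w\<close> shows that the limit
  is positive. Convergence for each vertex and uniform smallness of the tail give the convergence
  of the maximum to the supremum of the limits.\<close>

section \<open>Maximal inequality for Markov chains with countably supported transitions\<close>

text \<open>A point lying in every \<open>E l\<close> lies in events of arbitrarily small
  probability. This turns maximal inequalities with a growing level, or a growing starting time,
  into almost sure statements with a random level or time.\<close>

lemma (in prob_space) AE_ex_not_of_prob_tendsto_0:
  assumes "\<And>l. E l \<in> events" and "\<And>l. prob (E l) \<le> c l" and "c \<longlonglongrightarrow> 0"
  shows "AE \<omega> in M. \<exists>l::nat. \<omega> \<notin> E l"
proof -
  have "prob (\<Inter>l. E l) \<le> c l" for l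
    by (rule order_trans[OF finite_measure_mono assms(2)]) (use assms(1) in auto)
  then have "prob (\<Inter>l. E l) \<le> 0"
    by (intro LIMSEQ_le_const[OF assms(3)]) auto
  then have "prob (\<Inter>l. E l) = 0"
    using measure_nonneg[of M] by (meson antisym)
  moreover have "(\<Inter>l. E l) \<in> events"
    using assms(1) by auto
  ultimately have "(\<Inter>l. E l) \<in> null_sets M"
    by (simp add: null_sets_def emeasure_eq_measure)
  from AE_not_in[OF this] show ?thesis
    by eventually_elim auto
qed

text \<open>The state space may be uncountable, but discrete transitions concentrate the law up to
  time n on countably many paths, so the Markov property for single paths determines it. The
  time-dependent invariant \<open>I\<close> restricts later hypotheses on the chain to states that
  can matter.\<close>

locale discrete_chain = prob_space M
  for M :: "'a measure" +
  fixes K :: "'s \<Rightarrow> 's pmf" and x0 :: 's and X :: "nat \<Rightarrow> 'a \<Rightarrow> 's"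
    and I :: "nat \<Rightarrow> 's \<Rightarrow> bool"
  assumes measurable_X: "X n \<in> measurable M (count_space UNIV)"
    and AE_X_0: "AE \<omega> in M. X 0 \<omega> = x0"
    and path_prob: "prob {\<omega> \<in> space M. \<forall>k\<le>Suc n. X k \<omega> = x k} =
      prob {\<omega> \<in> space M. \<forall>k\<le>n. X k \<omega> = x k} * pmf (K (x n)) (x (Suc n))"
    and invariant_0: "I 0 x0"
    and invariant_Suc: "I n s \<Longrightarrow> t \<in> set_pmf (K s) \<Longrightarrow> I (Suc n) t"
begin

section \<open>The law of a finite initial path\<close>

text \<open>Paths up to time \<open>n\<close> are padded with \<open>x0\<close>, so that paths of
  every length share one type and each is determined by its first n + 1 values.\<close>

primrec path_pmf :: "nat \<Rightarrow> (nat \<Rightarrow> 's) pmf" where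
  "path_pmf 0 = return_pmf (\<lambda>_. x0)"
| "path_pmf (Suc n) = bind_pmf (path_pmf n) (\<lambda>x. map_pmf (\<lambda>y. x(Suc n := y)) (K (x n)))"

definition path_of :: "nat \<Rightarrow> 'a \<Rightarrow> nat \<Rightarrow> 's" where
  "path_of n \<omega> = (\<lambda>k. if k \<le> n then X k \<omega> else x0)"

lemma path_pmf_beyond: "x \<in> set_pmf (path_pmf n) \<Longrightarrow> n < k \<Longrightarrow> x k = x0"
  by (induction n arbitrary: x) auto

lemma path_pmf_invariant: "x \<in> set_pmf (path_pmf n) \<Longrightarrow> k \<le> n \<Longrightarrow> I k (x k)"
proof (induction n arbitrary: x k)
  case 0
  then show ?case by (simp add: invariant_0)
next
  case (Suc n)
  then obtain y t where y: "y \<in> set_pmf (path_pmf n)" "t \<in> set_pmf (K (y n))" "x = y(Suc n := t)"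
    by auto
  show ?case
    using Suc.IH[OF y(1), of k] Suc.IH[OF y(1), of n] y invariant_Suc[of n "y n" t] Suc.prems(2) by (cases "k = Suc n") auto
qed

text \<open>The padding makes the predecessor of \<open>z\<close> unique: only the path that agrees
  with \<open>z\<close> up to time n and equals \<open>x0\<close> afterwards contributes to the
  mixture.\<close>

lemma pmf_path_pmf_Suc:
  assumes "\<And>k. Suc n < k \<Longrightarrow> z k = x0"
  shows "pmf (path_pmf (Suc n)) z =
    pmf (path_pmf n) (z(Suc n := x0)) * pmf (K (z n)) (z (Suc n))"
proof -
  let ?z = "z(Suc n := x0)"
  have inj: "inj (\<lambda>y. x(Suc n := y))" for x :: "nat \<Rightarrow> 's"
    by (rule injI) (metis fun_upd_same)
  have "pmf (path_pmf (Suc n)) z =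
      (\<integral>x. pmf (map_pmf (\<lambda>y. x(Suc n := y)) (K (x n))) z \<partial>path_pmf n)"
    by (simp add: pmf_bind)
  also have "\<dots> = (\<integral>x. indicator {?z} x * pmf (K (z n)) (z (Suc n)) \<partial>path_pmf n)"
  proof (intro integral_cong_AE AE_pmfI)
    fix x assume x: "x \<in> set_pmf (path_pmf n)"
    show "pmf (map_pmf (\<lambda>y. x(Suc n := y)) (K (x n))) z =
        indicator {?z} x * pmf (K (z n)) (z (Suc n))"
    proof (cases "x = ?z")
      case True
      then have z: "z = x(Suc n := z (Suc n))" by auto
      have "pmf (map_pmf (\<lambda>y. x(Suc n := y)) (K (x n))) z = pmf (K (x n)) (z (Suc n))"
        by (subst z) (rule pmf_map_inj'[OF inj])
      with True show ?thesis by simp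
    next
      case False
      have "x (Suc n) = x0" using path_pmf_beyond[OF x] by simp
      with False have "z \<notin> set_pmf (map_pmf (\<lambda>y. x(Suc n := y)) (K (x n)))"
        by auto
      then have "pmf (map_pmf (\<lambda>y. x(Suc n := y)) (K (x n))) z = 0"
        by (simp add: pmf_eq_0_set_pmf)
      with False show ?thesis by simp
    qed
  qed auto
  also have "\<dots> = pmf (path_pmf n) ?z * pmf (K (z n)) (z (Suc n))"
    by (simp add: pmf.rep_eq)
  finally show ?thesis .
qed

lemma prob_path:
  assumes "\<And>k. n < k \<Longrightarrow> z k = x0"
  shows "prob {\<omega> \<in> space M. \<forall>k\<le>n. X k \<omega> = z k} = pmf (path_pmf n) z"
  using assms
proof (induction n arbitrary: z)
  case 0
  have eq: "z = (\<lambda>_. x0) \<longleftrightarrow> z 0 = x0"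
    using 0 by (metis bot_nat_0.not_eq_extremum)
  have "prob {\<omega> \<in> space M. X 0 \<omega> = z 0} = (if z 0 = x0 then 1 else 0)"
  proof (cases "z 0 = x0")
    case True
    have "prob {\<omega> \<in> space M. X 0 \<omega> = x0} = 1"
      using AE_X_0 measurable_X[of 0] by (intro prob_Collect_eq_1[THEN iffD2]) auto
    with True show ?thesis by simp
  next
    case False
    have "prob {\<omega> \<in> space M. X 0 \<omega> = z 0} = 0"
      using AE_X_0 measurable_X[of 0] False by (intro prob_Collect_eq_0[THEN iffD2]) auto
    with False show ?thesis by simp
  qed
  then show ?case using eq by (auto simp: indicator_def)
next
  case (Suc n)
  have "prob {\<omega> \<in> space M. \<forall>k\<le>n. X k \<omega> = z k} =
      prob {\<omega> \<in> space M. \<forall>k\<le>n. X k \<omega> = (z(Suc n := x0)) k}"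
    by (rule arg_cong[where f = prob]) auto
  also have "\<dots> = pmf (path_pmf n) (z(Suc n := x0))"
    by (rule Suc.IH) (use Suc.prems in auto)
  finally show ?case
    using pmf_path_pmf_Suc[OF Suc.prems] by (simp add: path_prob)
qed

lemma events_X: "{\<omega> \<in> space M. P (X n \<omega>)} \<in> events"
proof -
  have "{\<omega> \<in> space M. P (X n \<omega>)} = X n -` {s. P s} \<inter> space M" by auto
  then show ?thesis using measurable_sets[OF measurable_X[of n], of "{s. P s}"] by simp
qed

lemma path_of_eq_sets: "{\<omega> \<in> space M. path_of n \<omega> = z} \<in> events"
  unfolding path_of_def fun_eq_iff
  by (intro sets.sets_Collect_countable_All events_X[of "\<lambda>s. (if k \<le> n then s else x0) = z k" for k])

text \<open>The set \<open>A\<close> is arbitrary; intersected with the countable support it becomes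
  a countable union of single paths, each of them measurable and of known probability.\<close>

lemma emeasure_path_of:
  "{\<omega> \<in> space M. path_of n \<omega> \<in> set_pmf (path_pmf n) \<inter> A} \<in> events"
  "emeasure M {\<omega> \<in> space M. path_of n \<omega> \<in> set_pmf (path_pmf n) \<inter> A} = emeasure (path_pmf n) A"
proof -
  let ?L = "set_pmf (path_pmf n) \<inter> A"
  let ?E = "\<lambda>z. {\<omega> \<in> space M. path_of n \<omega> = z}"
  have eq: "{\<omega> \<in> space M. path_of n \<omega> \<in> ?L} = (\<Union>z\<in>?L. ?E z)" by auto
  have L: "countable ?L" by (simp add: countable_Int1)
  show "{\<omega> \<in> space M. path_of n \<omega> \<in> ?L} \<in> events"
    unfolding eq using L path_of_eq_sets by (intro sets.countable_UN') auto
  have "emeasure M (?E z) = pmf (path_pmf n) z" if "z \<in> ?L" for z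
  proof -
    have z: "z k = x0" if "n < k" for k
      using path_pmf_beyond[of z n k] that \<open>z \<in> ?L\<close> by simp
    have "?E z = {\<omega> \<in> space M. \<forall>k\<le>n. X k \<omega> = z k}"
      using z by (auto simp: path_of_def fun_eq_iff)
    then show ?thesis using prob_path[OF z] by (simp add: emeasure_eq_measure)
  qed
  then have "emeasure M (\<Union>z\<in>?L. ?E z) = (\<integral>\<^sup>+z. pmf (path_pmf n) z \<partial>count_space ?L)"
    using L path_of_eq_sets
    by (subst emeasure_UN_countable) (auto simp: disjoint_family_on_def intro!: nn_integral_cong)
  also have "\<dots> = emeasure (path_pmf n) A"
    by (simp add: nn_integral_pmf emeasure_Int_set_pmf Int_commute)
  finally show "emeasure M {\<omega> \<in> space M. path_of n \<omega> \<in> ?L} = emeasure (path_pmf n) A"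
    unfolding eq .
qed

lemma AE_path_of: "AE \<omega> in M. path_of n \<omega> \<in> set_pmf (path_pmf n)"
proof -
  have "prob {\<omega> \<in> space M. path_of n \<omega> \<in> set_pmf (path_pmf n)} = 1"
    using emeasure_path_of(2)[of n UNIV] by (simp add: emeasure_eq_measure measure_pmf.emeasure_eq_1_AE)
  then show ?thesis
    using emeasure_path_of(1)[of n UNIV] by (subst (asm) prob_Collect_eq_1) auto
qed

lemma AE_invariant: "AE \<omega> in M. \<forall>n. I n (X n \<omega>)"
  unfolding AE_all_countable
proof
  fix n
  show "AE \<omega> in M. I n (X n \<omega>)"
    using AE_path_of[of n]
  proof eventually_elim
    case (elim \<omega>)
    from path_pmf_invariant[OF this, of n] show ?case by (simp add: path_of_def)
  qed
qed

lemma prob_path_of: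
  assumes "{\<omega> \<in> space M. Q (path_of n \<omega>)} \<in> events"
  shows "prob {\<omega> \<in> space M. Q (path_of n \<omega>)} = measure (path_pmf n) {z. Q z}"
proof -
  have "emeasure M {\<omega> \<in> space M. Q (path_of n \<omega>)} =
      emeasure M {\<omega> \<in> space M. path_of n \<omega> \<in> set_pmf (path_pmf n) \<inter> {z. Q z}}"
    using assms AE_path_of[of n] by (intro emeasure_eq_AE emeasure_path_of) auto
  then show ?thesis
    using emeasure_path_of(2)[of n "{z. Q z}"]
    by (simp add: emeasure_eq_measure measure_pmf.emeasure_eq_measure)
qed

section \<open>Stopping and the maximal inequality\<close>

text \<open>The integrand is \<open>F\<close> frozen at \<open>l\<close> from the first hit on, and
  set to 0 after a state violating \<open>good\<close> has been passed without a hit; its mean does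
  not increase with the horizon \<open>T\<close>. The first argument of \<open>F\<close> is the
  state at time \<open>n\<close>, so \<open>F\<close> may depend on where the chain stands when
  observation begins.\<close>

lemma nn_integral_path_maximal:
  fixes F :: "'s \<Rightarrow> nat \<Rightarrow> 's \<Rightarrow> ennreal" and c l :: ennreal
  assumes super: "\<And>s m t. n \<le> m \<Longrightarrow> I n s \<Longrightarrow> I m t \<Longrightarrow> good m t \<Longrightarrow>
      (\<integral>\<^sup>+t'. F s (Suc m) t' \<partial>K t) \<le> F s m t"
    and init: "\<And>s. I n s \<Longrightarrow> F s n s \<le> c"
    and "n \<le> T"
  defines "hit \<equiv> \<lambda>T z. \<exists>m\<in>{n..T}. l \<le> F (z n) m (z m) \<and> (\<forall>i\<in>{n..<m}. good i (z i))"
  shows "(\<integral>\<^sup>+z. (if hit T z then l else if \<forall>i\<in>{n..<T}. good i (z i) then F (z n) T (z T) else 0)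
    \<partial>path_pmf T) \<le> c"
  using \<open>n \<le> T\<close>
proof (induction T rule: dec_induct)
  case base
  have "(\<integral>\<^sup>+z. (if hit n z then l else if \<forall>i\<in>{n..<n}. good i (z i) then F (z n) n (z n) else 0)
      \<partial>path_pmf n) \<le> (\<integral>\<^sup>+z. c \<partial>path_pmf n)"
    using init path_pmf_invariant[of _ n n]
    by (intro nn_integral_mono_AE AE_pmfI) (auto simp: hit_def intro: order_trans)
  then show ?case by simp
next
  case (step T)
  let ?\<Phi> = "\<lambda>T z. if hit T z then l
    else if \<forall>i\<in>{n..<T}. good i (z i) then F (z n) T (z T) else 0"
  have "(\<integral>\<^sup>+z. ?\<Phi> (Suc T) z \<partial>path_pmf (Suc T)) =
      (\<integral>\<^sup>+z. (\<integral>\<^sup>+y. ?\<Phi> (Suc T) (z(Suc T := y)) \<partial>K (z T)) \<partial>path_pmf T)"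
    by (simp add: nn_integral_bind_pmf nn_integral_map_pmf)
  also have "\<dots> \<le> (\<integral>\<^sup>+z. ?\<Phi> T z \<partial>path_pmf T)"
  proof (intro nn_integral_mono_AE AE_pmfI)
    fix z assume z: "z \<in> set_pmf (path_pmf T)"
    have hit_old: "hit (Suc T) (z(Suc T := y)) \<longleftrightarrow> hit T z \<or>
        (l \<le> F (z n) (Suc T) y \<and> (\<forall>i\<in>{n..T}. good i (z i)))" for y
      unfolding hit_def using step.hyps
      by (simp add: atLeastAtMostSuc_conv atLeastLessThanSuc_atLeastAtMost) auto
    consider "hit T z" | "\<not> hit T z" "\<forall>i\<in>{n..T}. good i (z i)"
      | "\<not> hit T z" "\<not> (\<forall>i\<in>{n..T}. good i (z i))" by blast
    then show "(\<integral>\<^sup>+y. ?\<Phi> (Suc T) (z(Suc T := y)) \<partial>K (z T)) \<le> ?\<Phi> T z"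
    proof cases
      case 1
      then show ?thesis by (simp add: hit_old)
    next
      \<comment> \<open>If the hit happens exactly at time T + 1, then \<open>l\<close> is at most
        the value of \<open>F\<close>, so replacing \<open>l\<close> by \<open>F\<close> only
        increases the integral and the supermartingale property applies.\<close>
      case 2
      have "(\<integral>\<^sup>+y. ?\<Phi> (Suc T) (z(Suc T := y)) \<partial>K (z T)) \<le> (\<integral>\<^sup>+y. F (z n) (Suc T) y \<partial>K (z T))"
        using step.hyps by (intro nn_integral_mono) (simp add: hit_old 2)
      also have "\<dots> \<le> F (z n) T (z T)"
        using 2 step.hyps path_pmf_invariant[OF z] by (intro super) auto
      also have "\<dots> = ?\<Phi> T z"
        using 2 by simp
      finally show ?thesis .
    next
      case 3
      then have "\<not> (\<forall>i\<in>{n..<Suc T}. good i ((z(Suc T := y)) i))" for y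
        by (force simp: atLeastLessThanSuc_atLeastAtMost)
      moreover have "\<not> hit (Suc T) (z(Suc T := y))" for y
        using 3 hit_old[of y] by blast
      ultimately have "?\<Phi> (Suc T) (z(Suc T := y)) = 0" for y
        by (simp only: if_False)
      then show ?thesis by simp
    qed
  qed
  also have "\<dots> \<le> c" by (rule step.IH)
  finally show ?case .
qed

text \<open>Markov's inequality for the stopped process gives the bound up to the horizon n + T,
  uniformly in T; continuity from below then removes the horizon. The predicate \<open>hit\<close>
  describes the event in the terms of the application and only has to force \<open>F\<close> up to
  \<open>l\<close>.\<close>

lemma maximal_inequality:
  fixes F :: "'s \<Rightarrow> nat \<Rightarrow> 's \<Rightarrow> real"
  assumes nonneg: "\<And>s m t. n \<le> m \<Longrightarrow> I n s \<Longrightarrow> I m t \<Longrightarrow> 0 \<le> F s m t"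
    and super: "\<And>s m t. n \<le> m \<Longrightarrow> I n s \<Longrightarrow> I m t \<Longrightarrow> good m t \<Longrightarrow>
      (\<integral>\<^sup>+t'. ennreal (F s (Suc m) t') \<partial>K t) \<le> ennreal (F s m t)"
    and init: "\<And>s. I n s \<Longrightarrow> F s n s \<le> c"
    and "0 < l" "0 \<le> c"
    and hit: "\<And>s m t. n \<le> m \<Longrightarrow> I n s \<Longrightarrow> I m t \<Longrightarrow> hit s m t \<Longrightarrow> l \<le> F s m t"
    and meas: "\<And>m. {\<omega> \<in> space M. hit (X n \<omega>) m (X m \<omega>)} \<in> events"
  defines "E \<equiv> {\<omega> \<in> space M. \<exists>m\<ge>n. hit (X n \<omega>) m (X m \<omega>) \<and> (\<forall>i\<in>{n..<m}. good i (X i \<omega>))}"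
  shows "E \<in> events" and "prob E \<le> c / l"
proof -
  define Q where "Q T z \<longleftrightarrow>
    (\<exists>m\<in>{n..T}. hit (z n) m (z m) \<and> (\<forall>i\<in>{n..<m}. good i (z i)))" for T and z :: "nat \<Rightarrow> 's"
  let ?A = "\<lambda>T. {\<omega> \<in> space M. Q (n + T) (path_of (n + T) \<omega>)}"
  have good: "{\<omega> \<in> space M. good i (X i \<omega>)} \<in> events" for i
    by (rule events_X)
  have Q_eq: "Q (n + T) (path_of (n + T) \<omega>) \<longleftrightarrow>
      (\<exists>m\<in>{n..n+T}. hit (X n \<omega>) m (X m \<omega>) \<and> (\<forall>i\<in>{n..<m}. good i (X i \<omega>)))" for T \<omega>
    by (auto simp: Q_def path_of_def)
  have A_sets: "?A T \<in> events" for T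
    unfolding Q_eq using meas good by measurable
  have E_eq: "E = (\<Union>T. ?A T)"
  proof (intro set_eqI iffI)
    fix \<omega> assume "\<omega> \<in> E"
    then obtain m where m: "n \<le> m" "hit (X n \<omega>) m (X m \<omega>)" "\<forall>i\<in>{n..<m}. good i (X i \<omega>)"
      and \<omega>: "\<omega> \<in> space M" unfolding E_def by blast
    have "Q (n + (m - n)) (path_of (n + (m - n)) \<omega>)"
      unfolding Q_eq using m by (intro bexI[of _ m]) auto
    with \<omega> show "\<omega> \<in> (\<Union>T. ?A T)" by blast
  qed (auto simp: E_def Q_eq)
  show "E \<in> events" unfolding E_eq using A_sets by auto
  have "prob (?A T) \<le> c / l" for T
  proof -
    let ?p = "path_pmf (n + T)"
    let ?F = "\<lambda>s m t. ennreal (F s m t)"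
    let ?hit = "\<lambda>z. \<exists>m\<in>{n..n+T}. ennreal l \<le> ?F (z n) m (z m) \<and> (\<forall>i\<in>{n..<m}. good i (z i))"
    have "ennreal l * emeasure ?p {z. Q (n + T) z} = (\<integral>\<^sup>+z. ennreal l * indicator {z. Q (n + T) z} z \<partial>?p)"
      by (simp add: nn_integral_cmult_indicator)
    also have "\<dots> \<le> (\<integral>\<^sup>+z. (if ?hit z then ennreal l
        else if \<forall>i\<in>{n..<n+T}. good i (z i) then ?F (z n) (n+T) (z (n+T)) else 0) \<partial>?p)"
    proof (intro nn_integral_mono_AE AE_pmfI)
      fix z assume z: "z \<in> set_pmf ?p"
      have "?hit z" if "Q (n + T) z"
      proof -
        from that obtain m where m: "m \<in> {n..n+T}" "hit (z n) m (z m)" "\<forall>i\<in>{n..<m}. good i (z i)"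
          unfolding Q_def by blast
        with hit[of m "z n" "z m"] path_pmf_invariant[OF z] show ?thesis
          by (intro bexI[of _ m]) (auto intro: ennreal_leI)
      qed
      then show "ennreal l * indicator {z. Q (n + T) z} z \<le> (if ?hit z then ennreal l
          else if \<forall>i\<in>{n..<n+T}. good i (z i) then ?F (z n) (n+T) (z (n+T)) else 0)"
        by (auto simp: indicator_def)
    qed
    also have "\<dots> \<le> ennreal c"
      using super init by (intro nn_integral_path_maximal) (auto intro: ennreal_leI)
    finally have "ennreal (l * measure ?p {z. Q (n + T) z}) \<le> ennreal c"
      using \<open>0 < l\<close> by (simp add: measure_pmf.emeasure_eq_measure ennreal_mult)
    then have "l * measure ?p {z. Q (n + T) z} \<le> c"
      using \<open>0 \<le> c\<close> by (simp add: ennreal_le_iff)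
    then have "measure ?p {z. Q (n + T) z} \<le> c / l"
      using \<open>0 < l\<close> by (simp add: field_simps)
    then show ?thesis using prob_path_of[OF A_sets] by simp
  qed
  moreover have "(\<lambda>T. prob (?A T)) \<longlonglongrightarrow> prob (\<Union>T. ?A T)"
  proof (rule finite_Lim_measure_incseq)
    show "range ?A \<subseteq> events" using A_sets by blast
    show "incseq ?A"
    proof (rule incseq_SucI)
      fix T
      have "{n..n + T} \<subseteq> {n..n + Suc T}" by auto
      then show "?A T \<subseteq> ?A (Suc T)" unfolding Q_eq by blast
    qed
  qed
  ultimately show "prob E \<le> c / l"
    unfolding E_eq by (intro LIMSEQ_le_const2) auto
qed

end

section \<open>One step of the model\<close>

lemma card_subsets_containing:
  assumes "finite S" and "1 \<le> m"
  shows "card {C. C \<subseteq> S \<and> card C = m \<and> j \<in> C} = (if j \<in> S then (card S - 1) choose (m - 1) else 0)"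
proof (cases "j \<in> S")
  case True
  let ?T = "{C. C \<subseteq> S - {j} \<and> card C = m - 1}"
  have fin: "finite C" if "C \<subseteq> S" for C using that assms(1) finite_subset by blast
  have "bij_betw (insert j) ?T {C. C \<subseteq> S \<and> card C = m \<and> j \<in> C}"
  proof (rule bij_betw_byWitness[where f' = "\<lambda>C. C - {j}"])
    show "insert j ` ?T \<subseteq> {C. C \<subseteq> S \<and> card C = m \<and> j \<in> C}"
      using True assms fin by (auto simp: card_insert_if subset_Diff_insert)
    show "(\<lambda>C. C - {j}) ` {C. C \<subseteq> S \<and> card C = m \<and> j \<in> C} \<subseteq> ?T"
      using fin by (auto simp: card_Diff_singleton)
  qed auto
  from bij_betw_same_card[OF this] True assms(1) show ?thesis
    by (simp add: n_subsets)
next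
  case False
  then have eq: "{C. C \<subseteq> S \<and> card C = m \<and> j \<in> C} = {}" by auto
  show ?thesis unfolding eq using False by simp
qed

lemma complete_edges_mono: "S \<subseteq> T \<Longrightarrow> complete_edges S \<subseteq> complete_edges T"
  unfolding complete_edges_def by blast

lemma finite_cliques: "finite (verts g) \<Longrightarrow> finite (cliques m g)"
  unfolding cliques_def by (rule finite_subset[of _ "Pow (verts g)"]) auto

text \<open>The two sum identities make preferential choice computable: every interaction adds 1 to
  each of the \<open>N choose m\<close> subsets of size m of its N vertices, and a participating
  vertex lies in \<open>(N - 1) choose (m - 1)\<close> of these. The second clause confines the
  weight to cliques, and the first makes the labels consecutive.\<close>

definition model_inv :: "nat \<Rightarrow> nat \<Rightarrow> wgraph \<Rightarrow> bool" where
  "model_inv N n g \<longleftrightarrow>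
     (\<exists>k\<ge>0. k \<le> int n \<and> verts g = {- (int N - 1)..k}) \<and>
     (\<forall>C. weight g C \<noteq> 0 \<longrightarrow> C \<subseteq> verts g \<and> complete_edges C \<subseteq> edges g) \<and>
     (\<forall>j\<in>verts g. 1 \<le> weight g {j}) \<and>
     (\<forall>m\<ge>1. (\<Sum>C\<in>cliques m g. weight g C) = Suc n * (N choose m)) \<and>
     (\<forall>m\<ge>1. \<forall>j. (\<Sum>C\<in>{C \<in> cliques m g. j \<in> C}. weight g C) =
        weight g {j} * ((N - 1) choose (m - 1)))"

text \<open>Drawing edges can also create cliques that are not contained in \<open>S\<close>; by the
  support hypothesis they have weight 0, so only subsets of \<open>S\<close> change the sum. Taking
  for \<open>P\<close> truth or membership of a vertex yields both sum identities of
  \<open>model_inv\<close>.\<close>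

lemma sum_weight_interact:
  assumes fin: "finite (verts g)" "finite S" and m: "1 \<le> m"
    and supp: "\<And>C. weight g C \<noteq> 0 \<Longrightarrow> C \<subseteq> verts g \<and> complete_edges C \<subseteq> edges g"
  shows "(\<Sum>C\<in>{C \<in> cliques m (interact S g). P C}. weight (interact S g) C) =
    (\<Sum>C\<in>{C \<in> cliques m g. P C}. weight g C) + card {C. C \<subseteq> S \<and> card C = m \<and> P C}"
proof -
  let ?g = "interact S g"
  let ?A = "{C \<in> cliques m ?g. P C}"
  have finA: "finite ?A"
    using fin by (intro finite_subset[OF _ finite_cliques[of ?g m]]) (auto simp: interact_def)
  have sub: "cliques m g \<subseteq> cliques m ?g"
    by (auto simp: cliques_def interact_def)
  have new: "C \<subseteq> S \<and> card C = m \<Longrightarrow> C \<in> cliques m ?g" for C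
    using complete_edges_mono[of C S] by (auto simp: cliques_def interact_def)
  have "(\<Sum>C\<in>?A. weight ?g C) = (\<Sum>C\<in>?A. weight g C + (if C \<subseteq> S then 1 else 0))"
    using m by (intro sum.cong) (auto simp: cliques_def interact_def)
  also have "\<dots> = (\<Sum>C\<in>?A. weight g C) + (\<Sum>C\<in>?A. if C \<subseteq> S then 1 else 0)"
    by (rule sum.distrib)
  also have "(\<Sum>C\<in>?A. weight g C) = (\<Sum>C\<in>{C \<in> cliques m g. P C}. weight g C)"
  proof (intro sum.mono_neutral_right ballI)
    fix C assume "C \<in> ?A - {C \<in> cliques m g. P C}"
    then show "weight g C = 0" using supp[of C] by (auto simp: cliques_def)
  qed (use sub finA in auto)
  also have "(\<Sum>C\<in>?A. if C \<subseteq> S then 1 else 0) = card {C \<in> ?A. C \<subseteq> S}"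
    using finA by (simp flip: sum.inter_filter)
  also have "{C \<in> ?A. C \<subseteq> S} = {C. C \<subseteq> S \<and> card C = m \<and> P C}"
    using new by (auto simp: cliques_def)
  finally show ?thesis .
qed

lemma model_inv_initial:
  assumes "1 \<le> N"
  shows "model_inv N 0 (initial_graph N)"
proof -
  let ?g = "initial_graph N" and ?V = "{- (int N - 1)..0}"
  have V: "verts ?g = ?V" "finite ?V" "card ?V = N" using assms by (auto simp: initial_graph_def Let_def)
  have cl: "{C \<in> cliques m ?g. P C} = {C. C \<subseteq> ?V \<and> card C = m \<and> P C}" for m P
    using complete_edges_mono[of _ ?V] by (auto simp: cliques_def initial_graph_def Let_def)
  have sum: "(\<Sum>C\<in>{C \<in> cliques m ?g. P C}. weight ?g C) = card {C. C \<subseteq> ?V \<and> card C = m \<and> P C}"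
    if "1 \<le> m" for m P
  proof -
    have "(\<Sum>C\<in>{C \<in> cliques m ?g. P C}. weight ?g C) = (\<Sum>C\<in>{C. C \<subseteq> ?V \<and> card C = m \<and> P C}. 1)"
      using that unfolding cl by (intro sum.cong) (auto simp: initial_graph_def Let_def)
    then show ?thesis by simp
  qed
  have 1: "(\<Sum>C\<in>cliques m ?g. weight ?g C) = N choose m" if "1 \<le> m" for m
    using sum[OF that, of "\<lambda>_. True"] V n_subsets[OF V(2), of m] by simp
  have 2: "(\<Sum>C\<in>{C \<in> cliques m ?g. j \<in> C}. weight ?g C) = weight ?g {j} * ((N - 1) choose (m - 1))"
    if "1 \<le> m" for m j
    using sum[OF that, of "\<lambda>C. j \<in> C"] card_subsets_containing[OF V(2) that, of j] V
    by (simp add: initial_graph_def Let_def)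
  show ?thesis unfolding model_inv_def
    using 1 2 V(1) complete_edges_mono[of _ ?V] by (auto simp: initial_graph_def Let_def split: if_splits)
qed

lemma model_inv_verts:
  assumes "model_inv N n g" and "1 \<le> N"
  shows "verts g = {- (int N - 1)..new_label N g - 1}" "finite (verts g)" "N \<le> card (verts g)"
    "new_label N g \<le> int n + 1" "new_label N g \<ge> 1"
proof -
  from assms(1) obtain k where k: "k \<ge> 0" "k \<le> int n" "verts g = {- (int N - 1)..k}"
    unfolding model_inv_def by blast
  then have "int (card (verts g)) = k + int N" using assms(2) by simp
  with k show "verts g = {- (int N - 1)..new_label N g - 1}" "finite (verts g)" "N \<le> card (verts g)"
    "new_label N g \<le> int n + 1" "new_label N g \<ge> 1" by (auto simp: new_label_def)
qed

lemma model_inv_weight_0: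
  assumes "model_inv N n g" "j \<notin> verts g"
  shows "weight g {j} = 0"
  using assms unfolding model_inv_def by blast

lemma model_inv_weight_ge_1:
  assumes "model_inv N n g" "j \<in> verts g"
  shows "1 \<le> weight g {j}"
  using assms unfolding model_inv_def by blast

lemma model_inv_interact:
  assumes inv: "model_inv N n g" and S: "finite S" "card S = N" "1 \<le> N"
    and verts: "S \<subseteq> verts g \<or> (\<exists>A. A \<subseteq> verts g \<and> S = insert (new_label N g) A)"
  shows "model_inv N (Suc n) (interact S g)"
proof -
  let ?g = "interact S g"
  note V = model_inv_verts[OF inv S(3)]
  have supp: "C \<subseteq> verts g \<and> complete_edges C \<subseteq> edges g" if "weight g C \<noteq> 0" for C
    using inv that unfolding model_inv_def by blast
  have 0: "\<exists>k\<ge>0. k \<le> int (Suc n) \<and> verts ?g = {- (int N - 1)..k}"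
  proof (cases "S \<subseteq> verts g")
    case True
    then have "verts ?g = {- (int N - 1)..new_label N g - 1}"
      using V(1) by (auto simp: interact_def)
    then show ?thesis using V by (intro exI[of _ "new_label N g - 1"]) auto
  next
    case False
    with verts obtain A where A: "A \<subseteq> verts g" "S = insert (new_label N g) A" by blast
    have "verts ?g = insert (new_label N g) {- (int N - 1)..new_label N g - 1}"
      using V(1) A by (auto simp: interact_def)
    also have "\<dots> = {- (int N - 1)..new_label N g}"
      using V(5) by auto
    finally have "verts ?g = {- (int N - 1)..new_label N g}" .
    then show ?thesis using V by (intro exI[of _ "new_label N g"]) auto
  qed
  have 1: "C \<subseteq> verts ?g \<and> complete_edges C \<subseteq> edges ?g" if "weight ?g C \<noteq> 0" for C
    using supp[of C] complete_edges_mono[of C S] that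
    by (auto simp: interact_def split: if_splits)
  have 2: "1 \<le> weight ?g {j}" if "j \<in> verts ?g" for j
    using model_inv_weight_ge_1[OF inv, of j] that by (auto simp: interact_def)
  note sum = sum_weight_interact[OF V(2) S(1) _ supp]
  have 3: "(\<Sum>C\<in>cliques m ?g. weight ?g C) = Suc (Suc n) * (N choose m)" if "1 \<le> m" for m
    using sum[OF that, of "\<lambda>_. True"] inv that n_subsets[OF S(1), of m] S
    unfolding model_inv_def by simp
  have 4: "(\<Sum>C\<in>{C \<in> cliques m ?g. j \<in> C}. weight ?g C) = weight ?g {j} * ((N - 1) choose (m - 1))"
    if "1 \<le> m" for m j
  proof -
    have "(\<Sum>C\<in>{C \<in> cliques m g. j \<in> C}. weight g C) = weight g {j} * ((N - 1) choose (m - 1))"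
      using inv that unfolding model_inv_def by blast
    then show ?thesis
      using sum[OF that, of "\<lambda>C. j \<in> C"] card_subsets_containing[OF S(1) that, of j] S
      by (simp add: interact_def)
  qed
  show ?thesis unfolding model_inv_def using 0 1 2 3 4 by blast
qed

locale interaction_params =
  fixes N :: nat and p q r :: real
  assumes N: "3 \<le> N" and p: "0 < p" "p \<le> 1" and q: "q \<in> {0..1}" and r: "r \<in> {0..1}"
begin

section \<open>Transition probabilities of one step\<close>

lemma prob_uniform_subset:
  assumes "finite (verts g)" "1 \<le> m" "m \<le> card (verts g)" "j \<in> verts g"
  shows "measure (uniform_subset_pmf m g) {S. j \<in> S} = real m / real (card (verts g))"
proof -
  let ?V = "verts g" let ?A = "{S. S \<subseteq> ?V \<and> card S = m}"
  have fin: "finite ?A" using assms(1) by simp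
  have card: "card ?A = card ?V choose m" using n_subsets[OF assms(1)] .
  then have ne: "?A \<noteq> {}" using assms(3) by (metis card.empty binomial_eq_0_iff not_less)
  have "?A \<inter> {S. j \<in> S} = {C. C \<subseteq> ?V \<and> card C = m \<and> j \<in> C}" by auto
  then have "measure (uniform_subset_pmf m g) {S. j \<in> S} =
      real ((card ?V - 1) choose (m - 1)) / real (card ?V choose m)"
    unfolding uniform_subset_pmf_def using ne fin card assms
    by (simp add: measure_pmf_of_set card_subsets_containing)
  \<comment> \<open>The absorption identity reduces the quotient of binomial coefficients to
    \<open>m / card (verts g)\<close>.\<close>
  moreover have "m * (card ?V choose m) = card ?V * ((card ?V - 1) choose (m - 1))"
    using assms(2) by (intro times_binomial_minus1_eq) auto
  then have "real m * real (card ?V choose m) = real (card ?V) * real ((card ?V - 1) choose (m - 1))"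
    by (metis of_nat_mult)
  moreover have "real (card ?V choose m) > 0" "real (card ?V) > 0"
    using assms(2,3) by simp_all
  ultimately show ?thesis
    by (simp add: frac_eq_eq mult.commute)
qed

lemma set_uniform_subset:
  assumes "finite (verts g)" "m \<le> card (verts g)"
  shows "set_pmf (uniform_subset_pmf m g) = {S. S \<subseteq> verts g \<and> card S = m}"
  unfolding uniform_subset_pmf_def
proof (rule set_pmf_of_set)
  show "{S. S \<subseteq> verts g \<and> card S = m} \<noteq> {}"
    using obtain_subset_with_card_n[OF assms(2)] by blast
qed (use assms in simp)

text \<open>The probability is the quotient of the two weight sums recorded in
  \<open>model_inv\<close>; the absorption identity turns the quotient of binomial coefficients into
  \<open>m / N\<close>.\<close>

lemma weighted_clique:
  assumes inv: "model_inv N n g" and m: "1 \<le> m" "m \<le> N"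
  shows "set_pmf (weighted_clique_pmf m g) \<subseteq> {S. S \<subseteq> verts g \<and> card S = m}"
    and "measure (weighted_clique_pmf m g) {S. j \<in> S} =
      real m / real N * real (weight g {j}) / (real n + 1)"
proof -
  have N1: "1 \<le> N" using N by simp
  note V = model_inv_verts[OF inv N1]
  have fin: "finite (cliques m g)" using V by (intro finite_cliques)
  have sum: "(\<Sum>y\<in>cliques m g. weight g y) = Suc n * (N choose m)"
    using inv m unfolding model_inv_def by blast
  then have sum': "(\<Sum>y\<in>cliques m g. real (weight g y)) = real (Suc n * (N choose m))"
    by (metis of_nat_sum)
  have sumj: "(\<Sum>C\<in>{C \<in> cliques m g. j \<in> C}. weight g C) = weight g {j} * ((N - 1) choose (m - 1))"
    using inv m unfolding model_inv_def by blast
  then have sumj': "(\<Sum>C\<in>{C \<in> cliques m g. j \<in> C}. real (weight g C)) =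
      real (weight g {j} * ((N - 1) choose (m - 1)))"
    by (metis of_nat_sum)
  have pos: "(\<Sum>y\<in>cliques m g. real (weight g y)) > 0"
  proof -
    have "0 < Suc n * (N choose m)" using m by simp
    then show ?thesis unfolding sum' by (simp only: of_nat_0_less_iff)
  qed
  note pmf = pmf_weighted_pmf[OF fin pos, folded weighted_clique_pmf_def]
  show sub: "set_pmf (weighted_clique_pmf m g) \<subseteq> {S. S \<subseteq> verts g \<and> card S = m}"
    using pmf by (auto simp: set_pmf_iff cliques_def split: if_splits)
  have "set_pmf (weighted_clique_pmf m g) \<subseteq> cliques m g"
    using pmf by (auto simp: set_pmf_iff split: if_splits)
  then have "measure (weighted_clique_pmf m g) {S. j \<in> S} =
      measure (weighted_clique_pmf m g) {C \<in> cliques m g. j \<in> C}"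
    by (intro measure_pmf.finite_measure_eq_AE AE_pmfI) auto
  also have "\<dots> = (\<Sum>C\<in>{C \<in> cliques m g. j \<in> C}. pmf (weighted_clique_pmf m g) C)"
    using fin by (intro measure_measure_pmf_finite) auto
  also have "\<dots> = (\<Sum>C\<in>{C \<in> cliques m g. j \<in> C}. real (weight g C)) / real (Suc n * (N choose m))"
    unfolding sum_divide_distrib by (intro sum.cong) (auto simp: pmf sum')
  also have "\<dots> = real (weight g {j}) * real ((N - 1) choose (m - 1)) / (real (Suc n) * real (N choose m))"
    by (simp only: sumj' of_nat_mult)
  also have "\<dots> = real m / real N * real (weight g {j}) / (real n + 1)"
  proof -
    have "m * (N choose m) = N * ((N - 1) choose (m - 1))"
      using m by (intro times_binomial_minus1_eq) auto
    then have "real m * real (N choose m) = real N * real ((N - 1) choose (m - 1))"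
      by (metis of_nat_mult)
    then have "real ((N - 1) choose (m - 1)) = real m / real N * real (N choose m)"
      using N by (simp add: field_simps)
    moreover have "real (N choose m) \<noteq> 0" using m by simp
    moreover have "w * (x * c) / (k * c) = x * w / k" if "c \<noteq> 0" for w x c k :: real
      using that by simp
    ultimately show ?thesis by (simp only: of_nat_Suc add.commute[of 1])
  qed
  finally show "measure (weighted_clique_pmf m g) {S. j \<in> S} =
      real m / real N * real (weight g {j}) / (real n + 1)" .
qed

text \<open>The constant \<beta> from above: the mean number of old vertices that one step selects
  by uniform choice.\<close>

definition uniform_rate :: real where
  "uniform_rate = p * (1 - r) * (real N - 1) + (1 - p) * (1 - q) * real N"

lemma measure_bind_bernoulli:
  assumes "c \<in> {0..1}"
  shows "measure (bind_pmf (bernoulli_pmf c) f) A = c * measure (f True) A + (1 - c) * measure (f False) A"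
proof -
  have "ennreal (measure (bind_pmf (bernoulli_pmf c) f) A) = (\<integral>\<^sup>+b. emeasure (f b) A \<partial>bernoulli_pmf c)"
    by (simp add: emeasure_bind_pmf flip: measure_pmf.emeasure_eq_measure)
  also have "\<dots> = ennreal (c * measure (f True) A + (1 - c) * measure (f False) A)"
    using assms by (simp add: measure_pmf.emeasure_eq_measure mult.commute flip: ennreal_mult ennreal_plus)
  finally show ?thesis using assms by (subst (asm) ennreal_inj) auto
qed

text \<open>The common form of both branches: size N - 1 with parameter \<open>r\<close> when a
  vertex is added, size N with parameter \<open>q\<close> otherwise.\<close>

definition choice_pmf :: "real \<Rightarrow> nat \<Rightarrow> wgraph \<Rightarrow> int set pmf" where
  "choice_pmf c m g = bind_pmf (bernoulli_pmf c)
     (\<lambda>b. if b then weighted_clique_pmf m g else uniform_subset_pmf m g)"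

lemma interacting_pmf_eq:
  "interacting_pmf N p q r g = bind_pmf (bernoulli_pmf p)
     (\<lambda>b. if b then map_pmf (insert (new_label N g)) (choice_pmf r (N - 1) g) else choice_pmf q N g)"
  unfolding interacting_pmf_def choice_pmf_def map_pmf_def bind_assoc_pmf by (rule refl)

lemma set_choice:
  assumes "model_inv N n g" "1 \<le> m" "m \<le> N"
  shows "set_pmf (choice_pmf c m g) \<subseteq> {S. S \<subseteq> verts g \<and> card S = m}"
proof -
  have "1 \<le> N" using N by simp
  note V = model_inv_verts(2,3)[OF assms(1) this]
  have "set_pmf (if b then weighted_clique_pmf m g else uniform_subset_pmf m g)
      \<subseteq> {S. S \<subseteq> verts g \<and> card S = m}" for b
    using weighted_clique(1)[OF assms] set_uniform_subset[OF V(1), of m] V(2) assms(3)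
    by (cases b) simp_all
  then show ?thesis
    unfolding choice_pmf_def set_bind_pmf by blast
qed

lemma prob_choice:
  assumes "model_inv N n g" "j \<in> verts g" "1 \<le> m" "m \<le> N" "c \<in> {0..1}"
  shows "measure (choice_pmf c m g) {S. j \<in> S} =
    c * (real m / real N * (real (weight g {j}) / (real n + 1))) + (1 - c) * (real m * (1 / real (card (verts g))))"
proof -
  have "1 \<le> N" using N by simp
  note V = model_inv_verts(2,3)[OF assms(1) this]
  show ?thesis
    using weighted_clique(2)[OF assms(1,3,4), of j] prob_uniform_subset[OF V(1) assms(3) _ assms(2)] V(2) assms(4)
    by (simp add: choice_pmf_def measure_bind_bernoulli[OF assms(5)])
qed

lemma new_label_notin:
  assumes "model_inv N n g"
  shows "new_label N g \<notin> verts g"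
proof -
  have "1 \<le> N" using N by simp
  from model_inv_verts(1)[OF assms this] show ?thesis by auto
qed

lemma set_interacting:
  assumes inv: "model_inv N n g" and S: "S \<in> set_pmf (interacting_pmf N p q r g)"
  shows "finite S" "card S = N" "S \<subseteq> verts g \<or> (\<exists>A. A \<subseteq> verts g \<and> S = insert (new_label N g) A)"
proof -
  have N1: "1 \<le> N" using N by simp
  note fin = model_inv_verts(2)[OF inv N1]
  have "set_pmf (interacting_pmf N p q r g) \<subseteq>
      insert (new_label N g) ` set_pmf (choice_pmf r (N - 1) g) \<union> set_pmf (choice_pmf q N g)"
    unfolding interacting_pmf_eq set_bind_pmf
  proof (rule UN_least)
    fix b
    show "set_pmf (if b then map_pmf (insert (new_label N g)) (choice_pmf r (N - 1) g) else choice_pmf q N g)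
        \<subseteq> insert (new_label N g) ` set_pmf (choice_pmf r (N - 1) g) \<union> set_pmf (choice_pmf q N g)"
      by (cases b) simp_all
  qed
  then have "S \<in> insert (new_label N g) ` set_pmf (choice_pmf r (N - 1) g) \<union> set_pmf (choice_pmf q N g)"
    using S by (rule subsetD)
  then have "finite S \<and> card S = N \<and> (S \<subseteq> verts g \<or> (\<exists>A. A \<subseteq> verts g \<and> S = insert (new_label N g) A))"
  proof
    assume "S \<in> insert (new_label N g) ` set_pmf (choice_pmf r (N - 1) g)"
    then obtain A where A: "A \<in> set_pmf (choice_pmf r (N - 1) g)" and S_eq: "S = insert (new_label N g) A"
      by (rule imageE)
    have "1 \<le> N - 1" "N - 1 \<le> N" using N by simp_all
    from set_choice[OF inv this, of r] A have A': "A \<subseteq> verts g" "card A = N - 1" by blast+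
    have "finite A" using A'(1) fin by (rule finite_subset)
    moreover have "new_label N g \<notin> A" using new_label_notin[OF inv] A'(1) by (rule contra_subsetD[rotated])
    ultimately have "finite S" "card S = N" using A'(2) N unfolding S_eq by simp_all
    with A'(1) S_eq show ?thesis by blast
  next
    assume "S \<in> set_pmf (choice_pmf q N g)"
    with set_choice[OF inv N1 order.refl, of q] have "S \<subseteq> verts g" "card S = N" by blast+
    moreover from this(1) fin have "finite S" by (rule finite_subset)
    ultimately show ?thesis by simp
  qed
  then show "finite S" "card S = N" "S \<subseteq> verts g \<or> (\<exists>A. A \<subseteq> verts g \<and> S = insert (new_label N g) A)"
    by simp_all
qed

lemma model_inv_step:
  assumes "model_inv N n g" "h \<in> set_pmf (step_pmf N p q r g)"
  shows "model_inv N (Suc n) h"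
proof -
  from assms(2) obtain S where S: "S \<in> set_pmf (interacting_pmf N p q r g)" "h = interact S g"
    by (auto simp: step_pmf_def)
  have "1 \<le> N" using N by simp
  from model_inv_interact[OF assms(1) set_interacting(1,2)[OF assms(1) S(1)] this set_interacting(3)[OF assms(1) S(1)]]
  show ?thesis by (simp add: S(2))
qed

text \<open>Averaging over the branches, the factors \<open>(N - 1) / N\<close> and 1 of the
  weighted choices combine to \<alpha>, and the sizes N - 1 and N of the uniform choices to
  \<open>uniform_rate\<close>.\<close>

lemma prob_interacting:
  assumes inv: "model_inv N n g" and j: "j \<in> verts g"
  shows "measure (interacting_pmf N p q r g) {S. j \<in> S} =
    model_alpha N p q r * real (weight g {j}) / (real n + 1) + uniform_rate / real (card (verts g))"
proof -
  let ?x = "real (weight g {j}) / (real n + 1)" and ?y = "1 / real (card (verts g))"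
  let ?new = "map_pmf (insert (new_label N g)) (choice_pmf r (N - 1) g)"
  \<comment> \<open>The vertex \<open>j\<close> already exists, so it differs from the new label,
    and inserting that label does not affect whether \<open>j\<close> takes part.\<close>
  have "insert (new_label N g) -` {S. j \<in> S} = {S. j \<in> S}"
    using j new_label_notin[OF inv] by auto
  then have new_eq: "measure ?new {S. j \<in> S} =
      r * ((real N - 1) / real N * ?x) + (1 - r) * ((real N - 1) * ?y)"
    using prob_choice[OF inv j, of "N - 1" r] N r by (simp add: of_nat_diff)
  have old_eq: "measure (choice_pmf q N g) {S. j \<in> S} = q * ?x + (1 - q) * (real N * ?y)"
    using prob_choice[OF inv j, of N q] N q by simp
  have "measure (interacting_pmf N p q r g) {S. j \<in> S} =
      p * measure ?new {S. j \<in> S} + (1 - p) * measure (choice_pmf q N g) {S. j \<in> S}"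
    unfolding interacting_pmf_eq using p by (subst measure_bind_bernoulli) simp_all
  also have "\<dots> = model_alpha N p q r * ?x + uniform_rate * ?y"
  proof -
    have "p * (r * ((real N - 1) / real N * x) + (1 - r) * ((real N - 1) * y)) + (1 - p) * (q * x + (1 - q) * (real N * y))
      = model_alpha N p q r * x + uniform_rate * y" for x y
      by (simp add: model_alpha_def uniform_rate_def algebra_simps)
    then show ?thesis unfolding new_eq old_eq .
  qed
  finally show ?thesis by simp
qed

lemma weight_interact_singleton:
  "weight (interact S g) {j} = (if j \<in> S then weight g {j} + 1 else weight g {j})"
  by (simp add: interact_def)

section \<open>Expectations after one step\<close>

text \<open>The weight of \<open>j\<close> rises by 1 with probability \<open>\<pi>\<close> and
  otherwise stays. Written as value plus increment times \<open>\<pi>\<close>, the expectation can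
  be estimated from bounds on \<open>\<pi>\<close>; supermartingale properties for an existing
  vertex are checked in this form.\<close>

lemma nn_integral_step_weight:
  assumes inv: "model_inv N n g" and j: "j \<in> verts g" and \<phi>: "\<And>w. 0 \<le> \<phi> w"
  defines "\<pi> \<equiv> model_alpha N p q r * real (weight g {j}) / (real n + 1) + uniform_rate / real (card (verts g))"
  shows "(\<integral>\<^sup>+h. ennreal (\<phi> (weight h {j})) \<partial>step_pmf N p q r g) =
      ennreal (\<phi> (weight g {j}) + (\<phi> (weight g {j} + 1) - \<phi> (weight g {j})) * \<pi>)"
    and "0 \<le> \<pi>" "\<pi> \<le> 1"
proof -
  let ?P = "interacting_pmf N p q r g" and ?A = "{S. j \<in> S}" and ?w = "weight g {j}"
  have \<pi>: "measure ?P ?A = \<pi>" unfolding \<pi>_def by (rule prob_interacting[OF inv j])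
  then show "0 \<le> \<pi>" "\<pi> \<le> 1" using measure_pmf.prob_le_1[of ?P ?A] by (metis measure_nonneg, simp)
  have "(\<integral>\<^sup>+h. ennreal (\<phi> (weight h {j})) \<partial>step_pmf N p q r g) =
      (\<integral>\<^sup>+S. ennreal (\<phi> (?w + 1)) * indicator ?A S + ennreal (\<phi> ?w) * indicator (- ?A) S \<partial>?P)"
    unfolding step_pmf_def nn_integral_map_pmf weight_interact_singleton
    by (intro nn_integral_cong) (simp add: indicator_def)
  also have "\<dots> = ennreal (\<phi> (?w + 1)) * ennreal \<pi> + ennreal (\<phi> ?w) * ennreal (1 - \<pi>)"
  proof -
    have "measure ?P (- ?A) = 1 - \<pi>"
      using measure_pmf.prob_compl[of ?A ?P] \<pi> by (simp add: Compl_eq_Diff_UNIV)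
    with \<pi> show ?thesis
      by (simp add: nn_integral_add nn_integral_cmult_indicator measure_pmf.emeasure_eq_measure)
  qed
  also have "\<dots> = ennreal (\<phi> ?w + (\<phi> (?w + 1) - \<phi> ?w) * \<pi>)"
  proof -
    have "ennreal a * ennreal \<pi> + ennreal b * ennreal (1 - \<pi>) = ennreal (a * \<pi> + b * (1 - \<pi>))"
      if "0 \<le> a" "0 \<le> b" for a b
      using that \<open>0 \<le> \<pi>\<close> \<open>\<pi> \<le> 1\<close> by (simp add: ennreal_mult)
    moreover have "a * \<pi> + b * (1 - \<pi>) = b + (a - b) * \<pi>" for a b
      by (simp add: algebra_simps)
    ultimately show ?thesis using \<phi> by simp
  qed
  finally show "(\<integral>\<^sup>+h. ennreal (\<phi> (weight h {j})) \<partial>step_pmf N p q r g) =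
      ennreal (\<phi> ?w + (\<phi> (?w + 1) - \<phi> ?w) * \<pi>)" .
qed

lemma step_weight_new:
  assumes inv: "model_inv N n g" and j: "j \<notin> verts g" and h: "h \<in> set_pmf (step_pmf N p q r g)"
  shows "weight h {j} \<le> 1"
  using h model_inv_weight_0[OF inv j] by (auto simp: step_pmf_def weight_interact_singleton)

text \<open>Whatever the graph, exactly one vertex is added with probability \<open>p\<close> and
  none otherwise, so the vertex count is a walk with Bernoulli increments.\<close>

lemma nn_integral_step_card:
  assumes inv: "model_inv N n g" and \<phi>: "\<And>w. 0 \<le> \<phi> w"
  shows "(\<integral>\<^sup>+h. ennreal (\<phi> (card (verts h))) \<partial>step_pmf N p q r g) =
      ennreal (p * \<phi> (card (verts g) + 1) + (1 - p) * \<phi> (card (verts g)))"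
proof -
  have N1: "1 \<le> N" using N by simp
  note fin = model_inv_verts(2)[OF inv N1]
  let ?v = "card (verts g)" and ?f = "\<lambda>S. ennreal (\<phi> (card (verts (interact S g))))"
  have "(\<integral>\<^sup>+S. ?f (insert (new_label N g) S) \<partial>choice_pmf r (N - 1) g) =
      (\<integral>\<^sup>+S. ennreal (\<phi> (?v + 1)) \<partial>choice_pmf r (N - 1) g)"
  proof (intro nn_integral_cong_AE AE_pmfI)
    fix S assume "S \<in> set_pmf (choice_pmf r (N - 1) g)"
    moreover have "1 \<le> N - 1" "N - 1 \<le> N" using N by simp_all
    ultimately have "S \<subseteq> verts g" using set_choice[OF inv, of "N - 1" r] by blast
    then have "verts (interact (insert (new_label N g) S) g) = insert (new_label N g) (verts g)"
      by (auto simp: interact_def)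
    then show "?f (insert (new_label N g) S) = ennreal (\<phi> (?v + 1))"
      using new_label_notin[OF inv] fin by simp
  qed
  then have new: "(\<integral>\<^sup>+S. ?f S \<partial>map_pmf (insert (new_label N g)) (choice_pmf r (N - 1) g)) = ennreal (\<phi> (?v + 1))"
    by simp
  have "(\<integral>\<^sup>+S. ?f S \<partial>choice_pmf q N g) = (\<integral>\<^sup>+S. ennreal (\<phi> ?v) \<partial>choice_pmf q N g)"
  proof (intro nn_integral_cong_AE AE_pmfI)
    fix S assume "S \<in> set_pmf (choice_pmf q N g)"
    then have "S \<subseteq> verts g" using set_choice[OF inv, of N q] N by auto
    then show "?f S = ennreal (\<phi> ?v)"
      by (simp add: interact_def Un_absorb2)
  qed
  then have old: "(\<integral>\<^sup>+S. ?f S \<partial>choice_pmf q N g) = ennreal (\<phi> ?v)"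
    by simp
  have "(\<integral>\<^sup>+h. ennreal (\<phi> (card (verts h))) \<partial>step_pmf N p q r g) =
     (\<integral>\<^sup>+b. (if b then ennreal (\<phi> (?v + 1)) else ennreal (\<phi> ?v)) \<partial>bernoulli_pmf p)"
    unfolding step_pmf_def interacting_pmf_eq nn_integral_map_pmf[of "\<lambda>S. interact S g"] nn_integral_bind_pmf
  proof (intro nn_integral_cong)
    fix b
    show "(\<integral>\<^sup>+S. ?f S \<partial>(if b then map_pmf (insert (new_label N g)) (choice_pmf r (N - 1) g) else choice_pmf q N g)) =
        (if b then ennreal (\<phi> (?v + 1)) else ennreal (\<phi> ?v))"
      using new old by (cases b) simp_all
  qed
  also have "\<dots> = ennreal (p * \<phi> (?v + 1) + (1 - p) * \<phi> ?v)"
    using p \<phi> by (simp add: mult.commute flip: ennreal_mult ennreal_plus)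
  finally show ?thesis .
qed

end

section \<open>Normalising sequences\<close>

lemma power_le_pochhammer:
  fixes x :: real
  assumes "0 \<le> x"
  shows "x ^ k \<le> pochhammer x k"
proof (induction k)
  case (Suc k)
  have "x ^ k * x \<le> pochhammer x k * (x + real k)"
    using Suc.IH assms order_trans[OF zero_le_power Suc.IH] by (intro mult_mono) auto
  then show ?case by (simp add: pochhammer_Suc mult.commute)
qed simp

lemma pochhammer_mono_real:
  fixes x y :: real
  assumes "0 \<le> x" "x \<le> y"
  shows "pochhammer x k \<le> pochhammer y k"
  using assms unfolding pochhammer_prod by (intro prod_mono) auto

text \<open>The relative increment is \<open>k / x\<close>, so under a transition probability
  proportional to \<open>x\<close> the relative drift does not depend on \<open>x\<close>.\<close>

lemma pochhammer_shift_diff: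
  fixes x :: real
  assumes "0 < x"
  shows "pochhammer (x + 1) k - pochhammer x k = real k / x * pochhammer x k"
proof -
  have "x * pochhammer (x + 1) k = pochhammer x k * (x + real k)"
    by (metis pochhammer_rec pochhammer_Suc)
  with assms show ?thesis by (simp add: field_simps)
qed

section \<open>The normalising sequence\<close>

text \<open>The sequence \<open>C\<close> from above. Its ratio of consecutive values is exactly the
  mean factor by which preferential choice increases a weight.\<close>

definition growth :: "real \<Rightarrow> nat \<Rightarrow> real" where
  "growth \<alpha> m = (\<Prod>i<m. 1 + \<alpha> / (real i + 1))"

lemma growth_Suc: "growth \<alpha> (Suc m) = growth \<alpha> m * (1 + \<alpha> / (real m + 1))"
  by (simp add: growth_def)

lemma growth_0 [simp]: "growth \<alpha> 0 = 1"
  by (simp add: growth_def)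

lemma growth_ge_1: "0 < \<alpha> \<Longrightarrow> 1 \<le> growth \<alpha> m"
  unfolding growth_def by (intro prod_ge_1) auto

lemma growth_pos: "0 < \<alpha> \<Longrightarrow> 0 < growth \<alpha> m"
  using growth_ge_1[of \<alpha> m] by simp

text \<open>With ratios \<open>1 + 2 / (i + 1)\<close> the product is exactly
  \<open>(n + 1) * (n + 2) / 2\<close>, and Bernoulli's inequality compares the ratios of
  \<open>growth \<alpha> n ^ k\<close> with these. It makes \<open>1 / growth \<alpha> n ^ k\<close>
  summable.\<close>

lemma growth_power_ge:
  assumes "0 < \<alpha>" and "2 \<le> real k * \<alpha>"
  shows "(real n + 1) * (real n + 2) / 2 \<le> growth \<alpha> n ^ k"
proof (induction n)
  case (Suc n)
  have "1 + 2 / (real n + 1) \<le> 1 + real k * (\<alpha> / (real n + 1))"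
    using assms by (simp add: divide_right_mono)
  also have "\<dots> \<le> (1 + \<alpha> / (real n + 1)) ^ k"
  proof (rule Bernoulli_inequality)
    have "0 \<le> \<alpha> / (real n + 1)" using assms by simp
    then show "- 1 \<le> \<alpha> / (real n + 1)" by linarith
  qed
  finally have "(real n + 1) * (real n + 2) / 2 * (1 + 2 / (real n + 1)) \<le>
      growth \<alpha> n ^ k * (1 + \<alpha> / (real n + 1)) ^ k"
    using Suc.IH assms growth_pos[of \<alpha> n] by (intro mult_mono) auto
  moreover have "(real (Suc n) + 1) * (real (Suc n) + 2) / 2 = (real n + 1) * (real n + 2) / 2 * (1 + 2 / (real n + 1))"
    by (simp add: field_simps)
  ultimately show ?case by (simp only: growth_Suc power_mult_distrib)
qed simp

lemma growth_eq_pochhammer: "growth \<alpha> n = pochhammer (\<alpha> + 1) n / fact n"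
proof -
  have "pochhammer (\<alpha> + 1) n = (\<Prod>i<n. \<alpha> + 1 + real i)"
    by (simp add: pochhammer_prod atLeast0LessThan)
  moreover have "(fact n :: real) = (\<Prod>i<n. real i + 1)"
    by (simp add: fact_prod_Suc atLeast0LessThan add.commute)
  moreover have "growth \<alpha> n = (\<Prod>i<n. (\<alpha> + 1 + real i) / (real i + 1))"
    unfolding growth_def by (intro prod.cong) (auto simp: field_simps)
  ultimately show ?thesis by (simp add: prod_dividef)
qed

text \<open>For n > 0 the sequence is the reciprocal of
  \<open>\<alpha> * Gamma_series \<alpha> n\<close>, and
  \<open>\<alpha> * Gamma \<alpha> = Gamma (1 + \<alpha>)\<close>.\<close>

lemma growth_asymptotics:
  assumes "0 < \<alpha>"
  shows "(\<lambda>n. growth \<alpha> n * real n powr (- \<alpha>)) \<longlonglongrightarrow> 1 / Gamma (1 + \<alpha>)"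
proof -
  have ne: "Gamma \<alpha> \<noteq> 0" using Gamma_real_pos[OF assms] by (rule less_imp_neq[symmetric])
  have lim: "(\<lambda>n. inverse (\<alpha> * Gamma_series \<alpha> n)) \<longlonglongrightarrow> inverse (\<alpha> * Gamma \<alpha>)"
    by (intro tendsto_inverse tendsto_mult tendsto_const Gamma_series_LIMSEQ) (use assms ne in simp)
  have eq: "\<forall>\<^sub>F n in sequentially. inverse (\<alpha> * Gamma_series \<alpha> n) = growth \<alpha> n * real n powr (- \<alpha>)"
    using eventually_gt_at_top[of 0]
  proof eventually_elim
    case (elim n)
    have "pochhammer (\<alpha> + 1) n > 0" using assms by (intro pochhammer_pos) simp
    with elim assms show ?case
      by (simp add: Gamma_series_def growth_eq_pochhammer pochhammer_rec powr_def exp_minus field_simps)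
  qed
  have "\<alpha> \<notin> \<int>\<^sub>\<le>\<^sub>0" using assms nonpos_Ints_nonpos by fastforce
  then have "Gamma (1 + \<alpha>) = \<alpha> * Gamma \<alpha>"
    using Gamma_plus1[of \<alpha>] by (simp add: add.commute)
  with Lim_transform_eventually[OF lim eq] show ?thesis by (simp add: divide_inverse)
qed

lemma growth_at_top:
  assumes "0 < \<alpha>"
  shows "filterlim (growth \<alpha>) at_top sequentially"
proof -
  have "filterlim (\<lambda>n. growth \<alpha> n * real n powr (- \<alpha>) * real n powr \<alpha>) at_top sequentially"
    using assms Gamma_real_pos[of "1 + \<alpha>"]
    by (intro filterlim_tendsto_pos_mult_at_top[OF growth_asymptotics[OF assms]]) (simp, real_asymp)
  moreover have eq: "\<forall>\<^sub>F n in sequentially. growth \<alpha> n * real n powr (- \<alpha>) * real n powr \<alpha> = growth \<alpha> n"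
    using eventually_gt_at_top[of 0] by eventually_elim (simp add: mult.assoc flip: powr_add)
  ultimately show ?thesis using filterlim_cong[OF refl refl eq, of at_top] by simp
qed

lemma inverse_growth_tendsto_0:
  assumes "0 < \<alpha>"
  shows "(\<lambda>n. K / growth \<alpha> n) \<longlonglongrightarrow> 0"
  by (rule real_tendsto_divide_at_top[OF tendsto_const growth_at_top[OF assms]])

section \<open>A discrete inverse square root\<close>

text \<open>The product satisfies \<open>half_product w \<ge> 1 / (2 * sqrt w)\<close>, and its ratio of
  consecutive values \<open>1 - 1 / (2 * w)\<close> turns the drift of the weight into the factor
  \<open>1 - \<alpha> / (2 * (m + 1))\<close>, without error terms.\<close>

definition half_product :: "nat \<Rightarrow> real" where
  "half_product w = (\<Prod>i<w - 1. 1 - 1 / (2 * (real i + 1)))"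

lemma half_product_Suc: "1 \<le> w \<Longrightarrow> half_product (w + 1) = half_product w * (1 - 1 / (2 * real w))"
  by (cases w) (auto simp: half_product_def add.commute)

lemma half_product_nonneg: "0 \<le> half_product w"
  unfolding half_product_def by (intro prod_nonneg) (auto simp: field_simps)

lemma half_product_le_1: "half_product w \<le> 1"
  unfolding half_product_def by (intro prod_le_1) (auto simp: field_simps)

text \<open>Squaring avoids roots. The induction runs on the sharper claim with the factor
  \<open>w - 1\<close> in place of \<open>w\<close>, for \<open>w \<ge> 2\<close>, where
  \<open>(1 - 1 / (2 * y))\<^sup>2 * y \<ge> y - 1\<close> closes the step.\<close>

lemma half_product_ge:
  assumes "1 \<le> w"
  shows "1 \<le> 4 * real w * half_product w ^ 2"
proof -
  have *: "1 \<le> 4 * real (Suc v) * half_product (Suc (Suc v)) ^ 2" for v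
  proof (induction v)
    case 0
    then show ?case by (simp add: half_product_def power2_eq_square)
  next
    case (Suc v)
    let ?y = "real (Suc (Suc v))"
    have "(1 - 1 / (2 * y))\<^sup>2 * y = y - 1 + 1 / (4 * y)" if "0 < y" for y :: real
      using that by (simp add: field_simps power2_eq_square)
    from this[of ?y] have "real (Suc v) \<le> (1 - 1 / (2 * ?y))\<^sup>2 * ?y" by simp
    then have "4 * half_product (Suc (Suc v)) ^ 2 * real (Suc v) \<le>
        4 * half_product (Suc (Suc v)) ^ 2 * ((1 - 1 / (2 * ?y))\<^sup>2 * ?y)"
      by (intro mult_left_mono) auto
    moreover have "1 \<le> 4 * half_product (Suc (Suc v)) ^ 2 * real (Suc v)"
      using Suc.IH by (simp only: mult_ac)
    ultimately have "1 \<le> 4 * half_product (Suc (Suc v)) ^ 2 * ((1 - 1 / (2 * ?y))\<^sup>2 * ?y)"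
      by (rule order_trans[rotated])
    moreover have "half_product (Suc (Suc (Suc v))) = half_product (Suc (Suc v)) * (1 - 1 / (2 * ?y))"
      using half_product_Suc[of "Suc (Suc v)"] by simp
    ultimately show ?case
      by (simp only: power_mult_distrib mult_ac)
  qed
  show ?thesis
  proof (cases "w = 1")
    case True
    then show ?thesis by (simp add: half_product_def)
  next
    case False
    with assms obtain v where w: "w = Suc (Suc v)" by (metis Suc_pred' One_nat_def le_neq_implies_less less_numeral_extra(1) Suc_le_eq old.nat.exhaust not_less_eq_eq)
    have "4 * real (Suc v) * half_product w ^ 2 \<le> 4 * real w * half_product w ^ 2"
      using w by (intro mult_right_mono) auto
    with *[of v] w show ?thesis by simp
  qed
qed

section \<open>Maxima over growing index ranges\<close>

text \<open>A single index with limit above \<open>y\<close> bounds the maximum from below once it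
  belongs to the range. From above, the tail hypothesis leaves finitely many indices, which are
  handled one by one.\<close>

lemma SUP_tendsto_Max:
  fixes a :: "nat \<Rightarrow> int \<Rightarrow> real" and A :: "int \<Rightarrow> real"
  assumes lim: "\<And>j. j0 \<le> j \<Longrightarrow> (\<lambda>n. a n j) \<longlonglongrightarrow> A j"
    and tail: "\<And>e. 0 < e \<Longrightarrow> \<exists>J. \<forall>j\<ge>J. \<forall>n. a n j < e"
    and "j0 \<le> 0" and nonneg: "0 \<le> A 0"
  shows "bdd_above (A ` {j0..})"
    and "(\<lambda>n. Max (a n ` {j0..int n})) \<longlonglongrightarrow> (SUP j\<in>{j0..}. A j)"
proof -
  have A_tail: "A j \<le> e" if "\<forall>j\<ge>J. \<forall>n. a n j < e" "j0 \<le> j" "J \<le> j" for e J j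
    using that lim[of j] by (intro LIMSEQ_le_const2[of "\<lambda>n. a n j"]) (auto intro: less_imp_le)
  obtain J where J: "\<forall>j\<ge>J. \<forall>n. a n j < 1" using tail[of 1] by auto
  have "A ` {j0..} \<subseteq> A ` {j0..J} \<union> {..1}"
    using A_tail[OF J] by fastforce
  moreover have "bdd_above (A ` {j0..J} \<union> {..1})" by simp
  ultimately show bdd: "bdd_above (A ` {j0..})" by (rule bdd_above_mono[rotated])
  let ?S = "SUP j\<in>{j0..}. A j"
  have A_le: "A j \<le> ?S" if "j0 \<le> j" for j using bdd that by (intro cSUP_upper) auto
  then have S: "0 \<le> ?S" using nonneg assms(3) by (meson order_trans)
  show "(\<lambda>n. Max (a n ` {j0..int n})) \<longlonglongrightarrow> ?S"
  proof (rule order_tendstoI)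
    fix y assume "y < ?S"
    then obtain j where j: "j0 \<le> j" "y < A j"
      using less_cSUP_iff[OF _ bdd] by auto
    have "\<forall>\<^sub>F n in sequentially. y < a n j"
      using lim[OF j(1)] j(2) by (rule order_tendstoD)
    moreover have "\<forall>\<^sub>F n in sequentially. nat j \<le> n" by (rule eventually_ge_at_top)
    ultimately show "\<forall>\<^sub>F n in sequentially. y < Max (a n ` {j0..int n})"
    proof eventually_elim
      case (elim n)
      then have "a n j \<le> Max (a n ` {j0..int n})" using j by (intro Max_ge) auto
      with elim show ?case by simp
    qed
  next
    \<comment> \<open>Here \<open>y\<close> is positive because the supremum is at least
      \<open>A 0 \<ge> 0\<close>, so it can serve as threshold in the tail hypothesis.\<close>
    fix y assume y: "?S < y"
    with S obtain J where J: "\<forall>j\<ge>J. \<forall>n. a n j < y" using tail[of y] by auto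
    have "\<forall>\<^sub>F n in sequentially. \<forall>j\<in>{j0..J}. a n j < y"
      using A_le y lim by (intro eventually_ball_finite ballI order_tendstoD(2)[OF lim]) (auto intro: le_less_trans)
    then show "\<forall>\<^sub>F n in sequentially. Max (a n ` {j0..int n}) < y"
    proof eventually_elim
      case (elim n)
      have "a n j < y" if "j0 \<le> j" for j using elim J that by (cases "j \<le> J") auto
      then show ?case using assms(3) by (subst Max_less_iff) auto
    qed
  qed
qed

section \<open>Weights of the vertices\<close>

locale interactions = interaction_params N p q r + prob_space M
  for N p q r and M :: "'a measure" +
  fixes G :: "nat \<Rightarrow> 'a \<Rightarrow> wgraph" and \<alpha> :: real
  assumes model: "interactions_model M N p q r G"
    and alpha_eq: "\<alpha> = model_alpha N p q r" and alpha_pos: "0 < \<alpha>"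
begin

sublocale discrete_chain M "step_pmf N p q r" "initial_graph N" G "model_inv N"
proof
  show "G n \<in> measurable M (count_space UNIV)" for n
    using model by (simp add: interactions_model_def)
  show "AE \<omega> in M. G 0 \<omega> = initial_graph N"
    using model by (simp add: interactions_model_def)
  show "prob {\<omega> \<in> space M. \<forall>k\<le>Suc n. G k \<omega> = x k} =
      prob {\<omega> \<in> space M. \<forall>k\<le>n. G k \<omega> = x k} * pmf (step_pmf N p q r (x n)) (x (Suc n))" for x n
    using model by (simp add: interactions_model_def)
  show "model_inv N 0 (initial_graph N)"
    using N by (intro model_inv_initial) simp
qed (rule model_inv_step)

lemma measurable_G_fun: "(\<lambda>\<omega>. f (G n \<omega>)) \<in> borel_measurable M"
  by (rule measurable_compose[OF measurable_X]) simp

section \<open>Linear growth of the number of vertices\<close>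

text \<open>With V the number of vertices, each step multiplies the mean of
  \<open>(1 / 2) ^ V\<close> by \<open>1 - p / 2\<close>, which makes
  \<open>log 2 (1 / (1 - p / 2))\<close> a lower rate of growth for V. Half of it leaves room for
  additive constants.\<close>

definition density :: real where
  "density = log 2 (1 / (1 - p / 2)) / 2"

text \<open>Chosen so that, given \<open>many_vertices\<close>, the uniform part of the transition
  probability is at most the contribution of \<open>shift\<close> additional units of
  weight.\<close>

definition shift :: real where
  "shift = uniform_rate / (\<alpha> * density)"

definition many_vertices :: "nat \<Rightarrow> wgraph \<Rightarrow> bool" where
  "many_vertices m g \<longleftrightarrow> density * (real m + 1) \<le> real (card (verts g))"

text \<open>For an existing vertex \<open>j\<close>, the conditional probability of taking part in
  step m + 1 when \<open>g\<close> is the graph after m steps.\<close>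

definition drift :: "nat \<Rightarrow> wgraph \<Rightarrow> int \<Rightarrow> real" where
  "drift m g j = \<alpha> * real (weight g {j}) / (real m + 1) + uniform_rate / real (card (verts g))"

lemma density_pos: "0 < density"
  using p by (simp add: density_def)

lemma uniform_rate_nonneg: "0 \<le> uniform_rate"
  using N p q r by (simp add: uniform_rate_def)

lemma shift_nonneg: "0 \<le> shift"
  using alpha_pos density_pos uniform_rate_nonneg by (simp add: shift_def)

lemma drift_bounds:
  shows "\<alpha> / (real m + 1) * real (weight g {j}) \<le> drift m g j"
    and "many_vertices m g \<Longrightarrow> drift m g j \<le> \<alpha> / (real m + 1) * (real (weight g {j}) + shift)"
proof -
  show "\<alpha> / (real m + 1) * real (weight g {j}) \<le> drift m g j"
    using uniform_rate_nonneg by (simp add: drift_def)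
  assume "many_vertices m g"
  then have "uniform_rate / real (card (verts g)) \<le> uniform_rate / (density * (real m + 1))"
    using density_pos uniform_rate_nonneg unfolding many_vertices_def
    by (intro divide_left_mono) (auto intro!: mult_pos_pos intro: less_le_trans[rotated])
  also have "\<dots> = \<alpha> / (real m + 1) * shift"
    using alpha_pos density_pos by (simp add: shift_def)
  finally show "drift m g j \<le> \<alpha> / (real m + 1) * (real (weight g {j}) + shift)"
    by (simp add: drift_def algebra_simps)
qed

lemma nn_integral_step_weight_le:
  assumes "model_inv N m g" "j \<in> verts g" "\<And>w. 0 \<le> \<phi> w"
    and "\<phi> (weight g {j}) + (\<phi> (weight g {j} + 1) - \<phi> (weight g {j})) * drift m g j \<le> c"
  shows "(\<integral>\<^sup>+h. ennreal (\<phi> (weight h {j})) \<partial>step_pmf N p q r g) \<le> ennreal c"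
  using nn_integral_step_weight(1)[OF assms(1,2), of \<phi>, folded alpha_eq, folded drift_def] assms(3,4)
  by (simp add: ennreal_leI)

text \<open>Divided by powers of \<open>1 - p / 2\<close>, the process \<open>(1 / 2) ^ V\<close> is
  a nonnegative martingale with initial value at most 1. It stays below a random level almost
  surely, and logarithms turn this into a linear lower bound on V.\<close>

lemma AE_many_vertices: "AE \<omega> in M. \<forall>\<^sub>F m in sequentially. many_vertices m (G m \<omega>)"
proof -
  let ?\<rho> = "1 - p / 2"
  have \<rho>: "0 < ?\<rho>" "?\<rho> < 1" using p by auto
  let ?f = "\<lambda>m v. (1 / 2) ^ v / ?\<rho> ^ m"
  let ?E = "\<lambda>l. {\<omega> \<in> space M. \<exists>m\<ge>0. (real (Suc l) \<le> ?f m (card (verts (G m \<omega>)))) \<and> (\<forall>i\<in>{0..<m}. True)}"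
  have E: "?E l \<in> events" "prob (?E l) \<le> 1 / real (Suc l)" for l
  proof -
    have super: "(\<integral>\<^sup>+h. ennreal (?f (Suc m) (card (verts h))) \<partial>step_pmf N p q r g)
        \<le> ennreal (?f m (card (verts g)))" if "model_inv N m g" for m g
    proof -
      have "p * ?f (Suc m) (v + 1) + (1 - p) * ?f (Suc m) v = ?f m v" for v
      proof -
        have "p * ((1 / 2) * a / (?\<rho> * b)) + (1 - p) * (a / (?\<rho> * b)) = a / b" for a b
        proof -
          have "p * ((1 / 2) * c) + (1 - p) * c = ?\<rho> * c" for c
            by (simp add: algebra_simps)
          from this[of "a / (?\<rho> * b)"]
          have "p * ((1 / 2) * a / (?\<rho> * b)) + (1 - p) * (a / (?\<rho> * b)) = ?\<rho> * (a / (?\<rho> * b))"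
            by (simp only: times_divide_eq_right)
          also have "\<dots> = a / b"
          proof -
            have "c * (a / (c * b)) = a / b" if "c \<noteq> 0" for c using that by simp
            then show ?thesis using \<rho> by auto
          qed
          finally show ?thesis .
        qed
        from this[of "(1 / 2) ^ v" "?\<rho> ^ m"] show ?thesis by simp
      qed
      then show ?thesis
        using nn_integral_step_card[OF that, of "?f (Suc m)"] \<rho> by simp
    qed
    have "?f 0 v \<le> 1" for v by (simp add: power_le_one)
    note max = maximal_inequality[of 0 "\<lambda>_ m g. ?f m (card (verts g))" "\<lambda>_ _. True" 1 "real (Suc l)"
      "\<lambda>_ m g. real (Suc l) \<le> ?f m (card (verts g))"]
    have nonneg: "0 \<le> ?f m v" for m v using \<rho> by simp
    show "?E l \<in> events" "prob (?E l) \<le> 1 / real (Suc l)"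
      using super nonneg \<open>\<And>v. ?f 0 v \<le> 1\<close> by (intro max events_X; simp)+
  qed
  from AE_ex_not_of_prob_tendsto_0[OF E LIMSEQ_Suc[OF lim_1_over_n]] AE_space show ?thesis
  proof eventually_elim
    case (elim \<omega>)
    then obtain l where l: "?f m (card (verts (G m \<omega>))) < real (Suc l)" for m
      by (auto simp: not_le)
    have lower: "2 * density * real m - log 2 (real (Suc l)) < real (card (verts (G m \<omega>)))" for m
    proof -
      let ?v = "card (verts (G m \<omega>))"
      have "(1 / 2) ^ ?v < real (Suc l) * ?\<rho> ^ m"
        using l[of m] \<rho> by (simp only: pos_divide_less_eq zero_less_power)
      moreover have "0 < (1 / 2 :: real) ^ ?v" by simp
      ultimately have "log 2 ((1 / 2) ^ ?v) < log 2 (real (Suc l) * ?\<rho> ^ m)"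
        by (intro log_less) auto
      also have "log 2 (real (Suc l) * ?\<rho> ^ m) = log 2 (real (Suc l)) + real m * log 2 ?\<rho>"
        using \<rho> by (subst log_mult) (auto simp: log_nat_power)
      also have "log 2 ?\<rho> = - (2 * density)"
        using \<rho> by (simp add: density_def log_divide)
      also have "log 2 ((1 / 2) ^ ?v) = - real ?v"
        by (simp add: log_nat_power log_divide)
      finally show ?thesis by (simp add: mult_ac)
    qed
    \<comment> \<open>The slope \<open>2 * density\<close> exceeds \<open>density\<close>, so the
      logarithm of the random level is eventually absorbed.\<close>
    have "\<forall>\<^sub>F m in sequentially. density * (real m + 1) \<le> 2 * density * real m - log 2 (real (Suc l))"
      using density_pos by real_asymp
    then show ?case
      unfolding many_vertices_def
    proof eventually_elim
      case (elim m)
      with lower[of m] show ?case by simp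
    qed
  qed
qed

section \<open>Upper bounds on the weights\<close>

text \<open>\<alpha> is a convex combination, with coefficients \<open>1 - p\<close> and
  \<open>p\<close>, of \<open>q\<close> and \<open>(N - 1) / N * r\<close>. The bound is used where
  weights are estimated from below.\<close>

lemma alpha_le_1: "\<alpha> \<le> 1"
proof -
  have "(real N - 1) / real N * r \<le> 1 * 1"
    using N r by (intro mult_mono) auto
  then have "(real N - 1) / real N * r * p \<le> 1 * p" using p by (intro mult_right_mono) auto
  moreover have "(1 - p) * q \<le> (1 - p) * 1" using p q by (intro mult_left_mono) auto
  ultimately show ?thesis by (simp add: alpha_eq model_alpha_def mult_ac)
qed

text \<open>The increment contributes \<open>k / x\<close> and the upper bound on the drift
  \<open>\<alpha> / (m + 1) * x\<close>; their product is free of \<open>x\<close>, and Bernoulli's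
  inequality produces the power by which \<open>growth \<alpha> m ^ k\<close> increases.\<close>

lemma pochhammer_drift:
  assumes "many_vertices m g" "1 \<le> weight g {j}"
  defines "x \<equiv> real (weight g {j}) + shift"
  shows "pochhammer x k + (pochhammer (x + 1) k - pochhammer x k) * drift m g j
    \<le> pochhammer x k * (1 + \<alpha> / (real m + 1)) ^ k"
proof -
  have x: "0 < x" using assms shift_nonneg by (simp add: x_def)
  then have P: "0 < pochhammer x k" by (rule pochhammer_pos)
  let ?y = "\<alpha> / (real m + 1)"
  have "(pochhammer (x + 1) k - pochhammer x k) * drift m g j \<le> real k / x * pochhammer x k * (?y * x)"
    unfolding pochhammer_shift_diff[OF x] using drift_bounds(2)[OF assms(1), of j] x P
    by (intro mult_left_mono) (auto simp: x_def)
  also have "\<dots> = pochhammer x k * (real k * ?y)"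
  proof -
    have "real k / x * c * (y * x) = c * (real k * y)" for c y using x by simp
    then show ?thesis .
  qed
  finally have "pochhammer x k + (pochhammer (x + 1) k - pochhammer x k) * drift m g j
      \<le> pochhammer x k * (1 + real k * ?y)"
    by (simp only: distrib_left mult_1_right add_left_mono)
  also have "\<dots> \<le> pochhammer x k * (1 + ?y) ^ k"
  proof (intro mult_left_mono Bernoulli_inequality)
    have "0 \<le> ?y" using alpha_pos by simp
    then show "- 1 \<le> ?y" by linarith
  qed (use P in simp)
  finally show ?thesis .
qed

text \<open>Replacing the weight \<open>w\<close> by \<open>max w 1\<close> makes the supermartingale insensitive to the
  birth of the vertex.\<close>

lemma prob_weight_exceeds:
  fixes j :: int and n L k :: nat and l :: real
  assumes "0 < l" "1 \<le> L"
  defines "E \<equiv> {\<omega> \<in> space M. \<exists>m\<ge>n.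
      (weight (G n \<omega>) {j} \<le> L \<and> l * growth \<alpha> m \<le> real (weight (G m \<omega>) {j})) \<and>
      (\<forall>i\<in>{n..<m}. many_vertices i (G i \<omega>))}"
  shows "E \<in> events" and "prob E \<le> pochhammer (real L + shift) k / growth \<alpha> n ^ k / l ^ k"
proof -
  let ?P = "\<lambda>g. pochhammer (real (max 1 (weight g {j})) + shift) k"
  \<comment> \<open>Setting the function to 0 when the weight at time \<open>n\<close> exceeds
    \<open>L\<close> bounds its initial value by a constant.\<close>
  let ?F = "\<lambda>s m g. if weight s {j} \<le> L then ?P g / growth \<alpha> m ^ k else 0"
  let ?hit = "\<lambda>s m g. weight s {j} \<le> L \<and> l * growth \<alpha> m \<le> real (weight g {j})"
  have C: "0 < growth \<alpha> m" for m using growth_pos[OF alpha_pos] .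
  have P: "0 < pochhammer (real (max 1 w) + shift) k" for w :: nat
    using shift_nonneg by (intro pochhammer_pos) simp
  have super: "(\<integral>\<^sup>+h. ennreal (?P h / growth \<alpha> (Suc m) ^ k) \<partial>step_pmf N p q r g)
      \<le> ennreal (?P g / growth \<alpha> m ^ k)" if inv: "model_inv N m g" and good: "many_vertices m g" for m g
  proof -
    let ?c = "growth \<alpha> (Suc m) ^ k"
    have c: "0 < ?c" using C by simp
    have eq: "?P g * (1 + \<alpha> / (real m + 1)) ^ k / ?c = ?P g / growth \<alpha> m ^ k"
    proof -
      have "0 < 1 + \<alpha> / (real m + 1)" using alpha_pos by (simp add: add_pos_pos)
      then show ?thesis by (simp add: growth_Suc power_mult_distrib)
    qed
    show ?thesis
    proof (cases "j \<in> verts g")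
      case True
      let ?w = "weight g {j}" and ?p = "\<lambda>w. pochhammer (real (max 1 w) + shift) k"
      have w: "1 \<le> ?w" by (rule model_inv_weight_ge_1[OF inv True])
      have "?p ?w / ?c + (?p (?w + 1) / ?c - ?p ?w / ?c) * drift m g j
          = (?p ?w + (?p (?w + 1) - ?p ?w) * drift m g j) / ?c"
      proof -
        have "a / c + (b / c - a / c) * d = (a + (b - a) * d) / c" for a b c d :: real
          by (simp add: add_divide_distrib diff_divide_distrib algebra_simps)
        then show ?thesis .
      qed
      also have "\<dots> \<le> ?p ?w * (1 + \<alpha> / (real m + 1)) ^ k / ?c"
        using pochhammer_drift[OF good w, of k] w c
        by (intro divide_right_mono) (auto simp: max_def add_ac)
      also note eq
      finally show ?thesis
        using P c by (intro nn_integral_step_weight_le[OF inv True, of "\<lambda>w. ?p w / ?c"]) (auto intro: less_imp_le)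
    next
      case False
      have w: "weight g {j} = 0" by (rule model_inv_weight_0[OF inv False])
      have "(\<integral>\<^sup>+h. ennreal (?P h / ?c) \<partial>step_pmf N p q r g) = (\<integral>\<^sup>+h. ennreal (?P g / ?c) \<partial>step_pmf N p q r g)"
      proof (intro nn_integral_cong_AE AE_pmfI)
        fix h assume "h \<in> set_pmf (step_pmf N p q r g)"
        then have "weight h {j} \<le> 1" by (rule step_weight_new[OF inv False])
        then have "max 1 (weight h {j}) = max 1 (weight g {j})" using w by simp
        then show "ennreal (?P h / ?c) = ennreal (?P g / ?c)" by (simp only:)
      qed
      also have "\<dots> = ennreal (?P g / ?c)" by simp
      also have "\<dots> \<le> ennreal (?P g * (1 + \<alpha> / (real m + 1)) ^ k / ?c)"
      proof (intro ennreal_leI divide_right_mono)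
        have "1 \<le> (1 + \<alpha> / (real m + 1)) ^ k" using alpha_pos by (intro one_le_power) simp
        then have "?P g * 1 \<le> ?P g * (1 + \<alpha> / (real m + 1)) ^ k"
          using P by (intro mult_left_mono) (auto intro: less_imp_le)
        then show "?P g \<le> ?P g * (1 + \<alpha> / (real m + 1)) ^ k" by simp
      qed (use c in simp)
      also note eq
      finally show ?thesis .
    qed
  qed
  have F_nonneg: "0 \<le> ?F s m g" for s m g
    using P[of "weight g {j}"] C[of m] by (auto intro!: divide_nonneg_nonneg less_imp_le)
  have F_super: "(\<integral>\<^sup>+h. ennreal (?F s (Suc m) h) \<partial>step_pmf N p q r g) \<le> ennreal (?F s m g)"
    if "model_inv N m g" "many_vertices m g" for s m g
    using super[OF that] by (cases "weight s {j} \<le> L") simp_all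
  have F_init: "?F s n s \<le> pochhammer (real L + shift) k / growth \<alpha> n ^ k" for s
  proof (cases "weight s {j} \<le> L")
    case True
    then have "?P s \<le> pochhammer (real L + shift) k"
      using assms(2) shift_nonneg by (intro pochhammer_mono_real) auto
    with True C[of n] show ?thesis by (simp add: divide_right_mono)
  next
    case False
    have "0 < pochhammer (real L + shift) k" using assms(2) shift_nonneg by (intro pochhammer_pos) simp
    with False C[of n] show ?thesis by simp
  qed
  have F_hit: "l ^ k \<le> ?F s m g" if "?hit s m g" for s m g
  proof -
    \<comment> \<open>A rising factorial dominates the power, so a weight of
      \<open>l * growth \<alpha> m\<close> forces \<open>?F\<close> up to
      \<open>l ^ k\<close>.\<close>
    have "(l * growth \<alpha> m) ^ k \<le> (real (max 1 (weight g {j})) + shift) ^ k"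
      using that assms(1) C[of m] shift_nonneg by (intro power_mono) auto
    also have "\<dots> \<le> ?P g" using shift_nonneg by (intro power_le_pochhammer) simp
    finally show ?thesis using that C[of m] by (simp add: power_mult_distrib pos_le_divide_eq)
  qed
  have c_nonneg: "0 \<le> pochhammer (real L + shift) k / growth \<alpha> n ^ k"
    using pochhammer_pos[of "real L + shift" k] assms(2) shift_nonneg C[of n] by simp
  have meas: "{\<omega> \<in> space M. ?hit (G n \<omega>) m (G m \<omega>)} \<in> events" for m
    by (intro sets.sets_Collect_conj events_X)
  have lk: "0 < l ^ k" using assms(1) by simp
  note max = maximal_inequality[where F = ?F and good = many_vertices and hit = ?hit and n = n,
      OF F_nonneg F_super F_init lk c_nonneg F_hit meas]
  show "E \<in> events" unfolding E_def using max(1) by blast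
  show "prob E \<le> pochhammer (real L + shift) k / growth \<alpha> n ^ k / l ^ k"
    unfolding E_def using max(2) by blast
qed

text \<open>The case k = 1 with a level tending to infinity. The starting time and the weight at
  that time are random, so the estimate is first made simultaneously for all \<open>j\<close>,
  \<open>n\<close> and \<open>L\<close>.\<close>

lemma AE_weight_bounded:
  "AE \<omega> in M. \<forall>j. \<exists>b. \<forall>m. real (weight (G m \<omega>) {j}) \<le> b * growth \<alpha> m"
proof -
  let ?E = "\<lambda>j n L l. {\<omega> \<in> space M. \<exists>m\<ge>n.
      (weight (G n \<omega>) {j} \<le> L \<and> real (Suc l) * growth \<alpha> m \<le> real (weight (G m \<omega>) {j})) \<and>
      (\<forall>i\<in>{n..<m}. many_vertices i (G i \<omega>))}"
  have "AE \<omega> in M. \<exists>l. \<omega> \<notin> ?E j n (Suc L) l" for j n L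
  proof (rule AE_ex_not_of_prob_tendsto_0)
    show "?E j n (Suc L) l \<in> events" for l by (rule prob_weight_exceeds(1)) simp_all
    let ?c = "pochhammer (real (Suc L) + shift) 1 / growth \<alpha> n ^ 1"
    show "prob (?E j n (Suc L) l) \<le> ?c / real (Suc l) ^ 1" for l
      by (rule prob_weight_exceeds(2)) simp_all
    show "(\<lambda>l. ?c / real (Suc l) ^ 1) \<longlonglongrightarrow> 0"
      unfolding power_one_right by (rule LIMSEQ_Suc[OF lim_const_over_n])
  qed
  then have "AE \<omega> in M. \<forall>j n L. \<exists>l. \<omega> \<notin> ?E j n (Suc L) l"
    unfolding AE_all_countable by (intro allI)
  then show ?thesis using AE_many_vertices AE_space
  proof eventually_elim
    case (elim \<omega>)
    show ?case
    proof
      fix j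
      obtain n where n: "\<And>m. n \<le> m \<Longrightarrow> many_vertices m (G m \<omega>)"
        using elim(2) unfolding eventually_sequentially by blast
      obtain l where notin: "\<omega> \<notin> ?E j n (Suc (weight (G n \<omega>) {j})) l" using elim(1) by blast
      have l: "real (weight (G m \<omega>) {j}) \<le> real (Suc l) * growth \<alpha> m" if m: "n \<le> m" for m
      proof (rule ccontr)
        assume "\<not> real (weight (G m \<omega>) {j}) \<le> real (Suc l) * growth \<alpha> m"
        then have "real (Suc l) * growth \<alpha> m \<le> real (weight (G m \<omega>) {j})" by (simp only: not_le less_imp_le)
        moreover have "weight (G n \<omega>) {j} \<le> Suc (weight (G n \<omega>) {j})" by simp
        moreover have "\<forall>i\<in>{n..<m}. many_vertices i (G i \<omega>)" using n by simp
        ultimately show False using notin elim(3) m by blast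
      qed
      \<comment> \<open>The finitely many times before \<open>n\<close> are covered by the largest
        weight among them, as \<open>growth\<close> is at least 1.\<close>
      let ?b = "Max (insert (real (Suc l)) ((\<lambda>m. real (weight (G m \<omega>) {j})) ` {..<n}))"
      have "real (weight (G m \<omega>) {j}) \<le> ?b * growth \<alpha> m" for m
      proof (cases "n \<le> m")
        case True
        have "real (Suc l) * growth \<alpha> m \<le> ?b * growth \<alpha> m"
          using growth_pos[OF alpha_pos, of m] by (intro mult_right_mono Max_ge) auto
        with l[OF True] show ?thesis by simp
      next
        case False
        then have "real (weight (G m \<omega>) {j}) \<le> ?b" by (intro Max_ge) auto
        also have "\<dots> \<le> ?b * growth \<alpha> m"
        proof -
          have "real (Suc l) \<le> ?b" by (intro Max_ge) auto
          then have "0 \<le> ?b" by (rule order_trans[rotated]) simp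
          with growth_ge_1[OF alpha_pos, of m] have "?b * 1 \<le> ?b * growth \<alpha> m"
            by (rule mult_left_mono)
          then show ?thesis by (simp only: mult_1_right)
        qed
        finally show ?thesis .
      qed
      then show "\<exists>b. \<forall>m. real (weight (G m \<omega>) {j}) \<le> b * growth \<alpha> m" by blast
    qed
  qed
qed

text \<open>Label n + 1 is not in use after n steps, so its weight is 0 at time \<open>n\<close> and
  \<open>L = 1\<close> applies. For large k the bounds are summable in n, and Borel-Cantelli leaves
  finitely many exceptional labels for each level.\<close>

lemma AE_late_weights_small:
  "AE \<omega> in M. \<forall>e>0. \<exists>J. \<forall>j\<ge>J. \<forall>m. real (weight (G m \<omega>) {j}) < e * growth \<alpha> m"
proof -
  \<comment> \<open>The order makes \<open>k * \<alpha> \<ge> 2\<close>, so that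
    \<open>growth_power_ge\<close> gives quadratic decay.\<close>
  obtain k :: nat where k: "2 / \<alpha> \<le> real k" using real_arch_simple by blast
  then have k: "2 \<le> real k * \<alpha>" using alpha_pos by (simp add: field_simps)
  let ?E = "\<lambda>l n. {\<omega> \<in> space M. \<exists>m\<ge>n.
      (weight (G n \<omega>) {int (Suc n)} \<le> 1 \<and>
       1 / real (Suc l) * growth \<alpha> m \<le> real (weight (G m \<omega>) {int (Suc n)})) \<and>
      (\<forall>i\<in>{n..<m}. many_vertices i (G i \<omega>))}"
  have "AE \<omega> in M. \<forall>\<^sub>F n in sequentially. \<omega> \<in> space M - ?E l n" for l
  proof (rule borel_cantelli_AE1)
    show E: "?E l n \<in> events" for n by (rule prob_weight_exceeds(1)) simp_all
    let ?c = "pochhammer (real 1 + shift) k"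
    have c: "0 < ?c" using shift_nonneg by (intro pochhammer_pos) simp
    have "prob (?E l n) \<le> ?c / growth \<alpha> n ^ k / (1 / real (Suc l)) ^ k" for n
      by (rule prob_weight_exceeds(2)) simp_all
    also have "\<dots> n = ?c * real (Suc l) ^ k / growth \<alpha> n ^ k" for n
      by (simp add: power_divide)
    also have "\<dots> n \<le> ?c * real (Suc l) ^ k / ((real n + 1) * (real n + 2) / 2)" for n
      using growth_power_ge[OF alpha_pos k, of n] c growth_pos[OF alpha_pos, of n]
      by (intro divide_left_mono mult_pos_pos) auto
    finally have bound: "prob (?E l n) \<le> ?c * real (Suc l) ^ k / ((real n + 1) * (real n + 2) / 2)" for n .
    have "summable (\<lambda>n. ?c * real (Suc l) ^ k / ((real n + 1) * (real n + 2) / 2))"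
    proof -
      have "summable (\<lambda>n. 1 / ((real n + 1) * (real n + 2) / 2))"
      proof (rule summable_comparison_test'[of _ 0])
        have "summable (\<lambda>n. inverse (real (Suc n) ^ 2))"
          by (subst summable_Suc_iff) (rule inverse_power_summable, simp)
        from summable_mult[OF this, of 2] show "summable (\<lambda>n. 2 * inverse (real (Suc n) ^ 2))" .
        fix n
        have "inverse ((real n + 1) * (real n + 2)) \<le> inverse (real (Suc n) ^ 2)"
          by (rule le_imp_inverse_le) (simp_all add: power2_eq_square algebra_simps add_pos_nonneg)
        then show "norm (1 / ((real n + 1) * (real n + 2) / 2)) \<le> 2 * inverse (real (Suc n) ^ 2)"
          by (simp add: inverse_eq_divide)
      qed
      from summable_mult[OF this, of "?c * real (Suc l) ^ k"] show ?thesis by simp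
    qed
    then show "summable (\<lambda>n. prob (?E l n))"
      by (rule summable_comparison_test'[of _ 0]) (use bound in simp)
    show "emeasure M (?E l n) < \<infinity>" for n
      by (simp add: emeasure_eq_measure)
  qed
  then have "AE \<omega> in M. \<forall>l. \<forall>\<^sub>F n in sequentially. \<omega> \<in> space M - ?E l n"
    unfolding AE_all_countable by (intro allI)
  then show ?thesis using AE_many_vertices AE_invariant
  proof eventually_elim
    case (elim \<omega>)
    show ?case
    proof (intro allI impI)
      fix e :: real assume "0 < e"
      then obtain l where l: "1 / real (Suc l) < e" using nat_approx_posE by blast
      have "\<forall>\<^sub>F n in sequentially. \<forall>m\<ge>n. many_vertices m (G m \<omega>)"
        using elim(2) by (simp add: eventually_all_ge_at_top)
      moreover have "\<forall>\<^sub>F n in sequentially. \<omega> \<in> space M - ?E l n" using elim(1) by blast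
      ultimately have "\<forall>\<^sub>F n in sequentially. \<omega> \<in> space M - ?E l n \<and> (\<forall>m\<ge>n. many_vertices m (G m \<omega>))"
        by eventually_elim blast
      then obtain n0 where n0: "\<And>n. n0 \<le> n \<Longrightarrow> \<omega> \<in> space M - ?E l n \<and> (\<forall>m\<ge>n. many_vertices m (G m \<omega>))"
        unfolding eventually_sequentially by blast
      have "real (weight (G m \<omega>) {j}) < e * growth \<alpha> m" if j: "int (Suc n0) \<le> j" for j m
      proof -
        \<comment> \<open>By the bound on labels, \<open>n\<close> is the last time at which
          \<open>j\<close> cannot yet be in use.\<close>
        define n where "n = nat j - 1"
        have n: "j = int (Suc n)" "n0 \<le> n" using j by (auto simp: n_def)
        have C: "0 < growth \<alpha> m" by (rule growth_pos[OF alpha_pos])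
        have zero: "weight (G i \<omega>) {j} = 0" if "i \<le> n" for i
        proof (rule model_inv_weight_0)
          show inv: "model_inv N i (G i \<omega>)" using elim(3) by blast
          have "1 \<le> N" using N by simp
          from model_inv_verts(1,4)[OF inv this] that n show "j \<notin> verts (G i \<omega>)" by auto
        qed
        show ?thesis
        proof (cases "n \<le> m")
          case True
          have "\<omega> \<in> space M - ?E l n" "\<forall>i\<ge>n. many_vertices i (G i \<omega>)"
            using n0[OF n(2)] by blast+
          with True zero[of n] n have "\<not> 1 / real (Suc l) * growth \<alpha> m \<le> real (weight (G m \<omega>) {j})"
            by auto
          moreover have "1 / real (Suc l) * growth \<alpha> m < e * growth \<alpha> m"
            using l C by (intro mult_strict_right_mono)
          ultimately show ?thesis by linarith
        next
          case False
          then have "weight (G m \<omega>) {j} = 0" using zero[of m] by simp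
          then show ?thesis using C \<open>0 < e\<close> by simp
        qed
      qed
      then show "\<exists>J. \<forall>j\<ge>J. \<forall>m. real (weight (G m \<omega>) {j}) < e * growth \<alpha> m" by blast
    qed
  qed
qed

section \<open>Convergence of each normalised weight\<close>

text \<open>The quadratic term increases with the transition probability \<open>y\<close> and uses
  its upper bound; the cross term has a minus sign and uses the lower bound. Leaving
  \<open>b\<close> out of the cross term lets \<open>x * w\<close> cancel exactly against the change
  of normalisation.\<close>

lemma quadratic_drift:
  fixes w b x y C u :: real
  assumes "0 \<le> w" "0 \<le> b" "0 < C" "0 \<le> x" "0 \<le> u" "x * w \<le> y" "y \<le> x * (w + b)"
  defines "C' \<equiv> C * (1 + x)"
  defines "f \<equiv> \<lambda>w. (w + b) * (w + b + 1) / C'\<^sup>2 - 2 * u * (w / C') + u\<^sup>2"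
  shows "f w + (f (w + 1) - f w) * y \<le> (w + b) * (w + b + 1) / C\<^sup>2 - 2 * u * (w / C) + u\<^sup>2"
proof -
  have C': "0 < C'" using assms by (simp add: C'_def)
  \<comment> \<open>The increment of \<open>(w + b) * (w + b + 1)\<close> is
    \<open>2 * (w + b + 1)\<close>, hence the common factor \<open>w + b + 1\<close>.\<close>
  have "f w + (f (w + 1) - f w) * y =
      (w + b + 1) * (w + b + 2 * y) / C'\<^sup>2 - 2 * u * ((w + y) / C') + u\<^sup>2"
    by (simp add: f_def diff_divide_distrib add_divide_distrib algebra_simps)
  also have "\<dots> \<le> (w + b + 1) * ((w + b) * (1 + x)\<^sup>2) / C'\<^sup>2 - 2 * u * ((1 + x) * w / C') + u\<^sup>2"
  proof -
    have "w + b + 2 * y \<le> (w + b) * (1 + 2 * x)" using assms by (simp add: algebra_simps)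
    also have "\<dots> \<le> (w + b) * (1 + x)\<^sup>2"
      using assms by (intro mult_left_mono) (auto simp: power2_eq_square algebra_simps)
    finally have "(w + b + 1) * (w + b + 2 * y) / C'\<^sup>2 \<le> (w + b + 1) * ((w + b) * (1 + x)\<^sup>2) / C'\<^sup>2"
      using assms by (intro divide_right_mono mult_left_mono) auto
    moreover have "2 * u * ((1 + x) * w / C') \<le> 2 * u * ((w + y) / C')"
      using assms C' by (intro mult_left_mono divide_right_mono) (auto simp: algebra_simps)
    ultimately show ?thesis by linarith
  qed
  also have "(w + b + 1) * ((w + b) * (1 + x)\<^sup>2) / C'\<^sup>2 = (w + b) * (w + b + 1) / C\<^sup>2"
    using assms(3,4) by (simp add: C'_def power_mult_distrib mult_ac)
  also have "(1 + x) * w / C' = w / C"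
    using assms(3,4) by (simp add: C'_def)
  finally show ?thesis .
qed

text \<open>For \<open>w\<close> and \<open>C\<close> taken at time \<open>m \<ge> n\<close> and \<open>u\<close> fixed at time \<open>n\<close>, the function
  \<open>(w + b) * (w + b + 1) / C\<^sup>2 - 2 * u * (w / C) + u\<^sup>2\<close> of \<open>quadratic_drift\<close> equals
  \<open>(U - u)\<^sup>2 + U / C + 2 * u * b / C\<close> with \<open>U = (w + b) / C\<close>. So it dominates the squared
  oscillation, while its initial value for \<open>u = U\<close> is of order \<open>1 / C\<close>.\<close>

lemma prob_oscillation:
  fixes j :: int and n :: nat and e L :: real
  assumes "0 < e" "0 \<le> L"
  defines "U \<equiv> \<lambda>m (g :: wgraph). (real (weight g {j}) + shift) / growth \<alpha> m"
  defines "E \<equiv> {\<omega> \<in> space M. \<exists>m\<ge>n.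
      (U n (G n \<omega>) \<le> L \<and> e \<le> \<bar>U m (G m \<omega>) - U n (G n \<omega>)\<bar>) \<and>
      (\<forall>i\<in>{n..<m}. many_vertices i (G i \<omega>) \<and> j \<in> verts (G i \<omega>))}"
  shows "E \<in> events" and "prob E \<le> (1 + 2 * shift) * L / growth \<alpha> n / e\<^sup>2"
proof -
  let ?Z = "\<lambda>C u w. (w + shift) * (w + shift + 1) / C\<^sup>2 - 2 * u * (w / C) + u\<^sup>2"
  have C: "0 < growth \<alpha> m" for m using growth_pos[OF alpha_pos] .
  have Z_eq: "?Z c u w = ((w + shift) / c - u)\<^sup>2 + (w + shift) / c\<^sup>2 + 2 * u * shift / c" if "0 < c" for c u w :: real
    using that by (simp add: power2_eq_square field_simps)
  have Z_ge: "((w + shift) / c - u)\<^sup>2 \<le> ?Z c u w" if "0 < c" "0 \<le> u" "0 \<le> w" for c u w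
    using that shift_nonneg by (subst Z_eq) auto
  let ?F = "\<lambda>s m (g :: wgraph). if U n s \<le> L then ?Z (growth \<alpha> m) (U n s) (real (weight g {j})) else 0"
  let ?hit = "\<lambda>s m g. U n s \<le> L \<and> e \<le> \<bar>U m g - U n s\<bar>"
  \<comment> \<open>The vertex has to exist, since \<open>drift\<close> is its transition
    probability only then.\<close>
  let ?good = "\<lambda>m (g :: wgraph). many_vertices m g \<and> j \<in> verts g"
  have U: "0 \<le> U m g" for m g using C[of m] shift_nonneg by (simp add: U_def)
  have F_ge: "(U m g - U n s)\<^sup>2 \<le> ?F s m g" if "U n s \<le> L" for s m g
    using Z_ge[OF C U] that by (simp add: U_def)
  have F_nonneg: "0 \<le> ?F s m g" for s m g
  proof (cases "U n s \<le> L")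
    case True
    have "0 \<le> (U m g - U n s)\<^sup>2" by simp
    also have "\<dots> \<le> ?F s m g" by (rule F_ge[OF True])
    finally show ?thesis .
  qed simp
  have F_super: "(\<integral>\<^sup>+h. ennreal (?F s (Suc m) h) \<partial>step_pmf N p q r g) \<le> ennreal (?F s m g)"
    if inv: "model_inv N m g" and good: "?good m g" for s m g
  proof (cases "U n s \<le> L")
    case True
    let ?w = "weight g {j}" and ?x = "\<alpha> / (real m + 1)"
    let ?\<phi> = "\<lambda>v. ?Z (growth \<alpha> (Suc m)) (U n s) (real v)"
    have "?\<phi> ?w + (?\<phi> (?w + 1) - ?\<phi> ?w) * drift m g j \<le> ?Z (growth \<alpha> m) (U n s) (real ?w)"
      unfolding growth_Suc of_nat_add of_nat_1
    proof (rule quadratic_drift)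
      show "?x * real ?w \<le> drift m g j" by (rule drift_bounds(1))
      show "drift m g j \<le> ?x * (real ?w + shift)" using good by (intro drift_bounds(2)) simp
    qed (use shift_nonneg C[of m] alpha_pos U[of n s] in simp_all)
    moreover have "0 \<le> ?\<phi> v" for v
    proof -
      have "0 \<le> ((real v + shift) / growth \<alpha> (Suc m) - U n s)\<^sup>2" by simp
      also have "\<dots> \<le> ?\<phi> v" by (rule Z_ge[OF C U]) simp
      finally show ?thesis .
    qed
    ultimately have "(\<integral>\<^sup>+h. ennreal (?\<phi> (weight h {j})) \<partial>step_pmf N p q r g)
        \<le> ennreal (?Z (growth \<alpha> m) (U n s) (real ?w))"
      using good by (intro nn_integral_step_weight_le[OF inv, of j ?\<phi>]) auto
    with True show ?thesis by simp
  qed simp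
  have F_init: "?F s n s \<le> (1 + 2 * shift) * L / growth \<alpha> n" for s
  proof (cases "U n s \<le> L")
    case True
    have "?F s n s = (1 + 2 * shift) * U n s / growth \<alpha> n"
    proof -
      let ?w = "real (weight s {j})"
      have "?F s n s = ((?w + shift) / growth \<alpha> n - U n s)\<^sup>2 + (?w + shift) / (growth \<alpha> n)\<^sup>2
          + 2 * U n s * shift / growth \<alpha> n"
        using True Z_eq[OF C] by simp
      also have "\<dots> = U n s / growth \<alpha> n + 2 * U n s * shift / growth \<alpha> n"
        by (simp add: U_def power2_eq_square)
      also have "\<dots> = (1 + 2 * shift) * U n s / growth \<alpha> n"
        by (simp add: algebra_simps flip: add_divide_distrib)
      finally show ?thesis .
    qed
    also have "\<dots> \<le> (1 + 2 * shift) * L / growth \<alpha> n"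
      using True C[of n] shift_nonneg by (intro divide_right_mono mult_left_mono) auto
    finally show ?thesis .
  next
    case False
    then show ?thesis using C[of n] shift_nonneg assms(2) by simp
  qed
  have F_hit: "e\<^sup>2 \<le> ?F s m g" if "?hit s m g" for s m g
  proof -
    have "e\<^sup>2 \<le> \<bar>U m g - U n s\<bar>\<^sup>2" using that assms(1) by (intro power_mono) auto
    also have "\<dots> = (U m g - U n s)\<^sup>2" by simp
    also have "\<dots> \<le> ?F s m g" using that by (intro F_ge) simp
    finally show ?thesis .
  qed
  have meas: "{\<omega> \<in> space M. ?hit (G n \<omega>) m (G m \<omega>)} \<in> events" for m
  proof (intro sets.sets_Collect_conj events_X[of "\<lambda>g. U n g \<le> L"])
    have [measurable]: "(\<lambda>\<omega>. U m (G m \<omega>)) \<in> borel_measurable M" for m by (rule measurable_G_fun)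
    show "{\<omega> \<in> space M. e \<le> \<bar>U m (G m \<omega>) - U n (G n \<omega>)\<bar>} \<in> events" by measurable
  qed
  have c_nonneg: "0 \<le> (1 + 2 * shift) * L / growth \<alpha> n"
    using C[of n] shift_nonneg assms(2) by simp
  have e2: "0 < e\<^sup>2" using assms(1) by simp
  note max = maximal_inequality[where F = ?F and good = ?good and hit = ?hit and n = n,
      OF F_nonneg F_super F_init e2 c_nonneg F_hit meas]
  show "E \<in> events" unfolding E_def using max(1) by blast
  show "prob E \<le> (1 + 2 * shift) * L / growth \<alpha> n / e\<^sup>2"
    unfolding E_def using max(2) by blast
qed

text \<open>Labels are consecutive and start at \<open>-(N - 1)\<close>, so \<open>j\<close> is in
  use as soon as there are \<open>j + N\<close> vertices.\<close>

lemma eventually_verts: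
  assumes many: "\<forall>\<^sub>F m in sequentially. many_vertices m (G m \<omega>)"
    and inv: "\<And>m. model_inv N m (G m \<omega>)" and j: "- (int N - 1) \<le> j"
  shows "\<forall>\<^sub>F m in sequentially. j \<in> verts (G m \<omega>)"
proof -
  have "\<forall>\<^sub>F m in sequentially. real_of_int (j + int N) \<le> density * (real m + 1)"
    using density_pos by real_asymp
  with many show ?thesis
  proof eventually_elim
    case (elim m)
    have N1: "1 \<le> N" using N by simp
    have "j \<le> new_label N (G m \<omega>) - 1"
      using elim unfolding many_vertices_def new_label_def by linarith
    then show ?case using j by (subst model_inv_verts(1)[OF inv N1]) simp
  qed
qed

text \<open>The probability of an oscillation of fixed size after a starting time tends to 0 as that
  time grows. So almost surely some late starting time is followed by no such oscillation, which is
  the Cauchy property.\<close>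

lemma AE_weight_convergent:
  "AE \<omega> in M. \<forall>j\<ge>- (int N - 1). convergent (\<lambda>m. real (weight (G m \<omega>) {j}) / growth \<alpha> m)"
proof -
  let ?U = "\<lambda>j m g. (real (weight g {j}) + shift) / growth \<alpha> m"
  let ?E = "\<lambda>j L l n. {\<omega> \<in> space M. \<exists>m\<ge>n.
      (?U j n (G n \<omega>) \<le> real L \<and> 1 / real (Suc l) \<le> \<bar>?U j m (G m \<omega>) - ?U j n (G n \<omega>)\<bar>) \<and>
      (\<forall>i\<in>{n..<m}. many_vertices i (G i \<omega>) \<and> j \<in> verts (G i \<omega>))}"
  \<comment> \<open>The offset \<open>n0\<close> makes room for the random time from which
    \<open>many_vertices\<close> holds and \<open>j\<close> exists.\<close>
  have "AE \<omega> in M. \<exists>n. \<omega> \<notin> ?E j L l (n + n0)" for j L l n0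
  proof (rule AE_ex_not_of_prob_tendsto_0)
    show "?E j L l (n + n0) \<in> events" for n by (rule prob_oscillation(1)) simp_all
    let ?K = "(1 + 2 * shift) * real L"
    show "prob (?E j L l (n + n0)) \<le> ?K / growth \<alpha> (n + n0) / (1 / real (Suc l))\<^sup>2" for n
      by (rule prob_oscillation(2)) simp_all
    have "(\<lambda>n. ?K / growth \<alpha> (n + n0) / (1 / real (Suc l))\<^sup>2) \<longlonglongrightarrow> 0 / (1 / real (Suc l))\<^sup>2"
      by (intro tendsto_divide tendsto_const LIMSEQ_ignore_initial_segment[OF inverse_growth_tendsto_0[OF alpha_pos]]) simp
    then show "(\<lambda>n. ?K / growth \<alpha> (n + n0) / (1 / real (Suc l))\<^sup>2) \<longlonglongrightarrow> 0" by simp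
  qed
  then have "AE \<omega> in M. \<forall>j L l n0. \<exists>n. \<omega> \<notin> ?E j L l (n + n0)"
    unfolding AE_all_countable by (intro allI)
  then show ?thesis using AE_weight_bounded AE_many_vertices AE_invariant AE_space
  proof eventually_elim
    case (elim \<omega>)
    show ?case
    proof (intro allI impI)
      fix j :: int assume j: "- (int N - 1) \<le> j"
      have inv: "model_inv N m (G m \<omega>)" for m using elim(4) by blast
      let ?u = "\<lambda>m. ?U j m (G m \<omega>)"
      obtain b where b: "\<And>m. real (weight (G m \<omega>) {j}) \<le> b * growth \<alpha> m" using elim(2) by blast
      obtain L :: nat where L: "b + shift \<le> real L" using real_arch_simple by blast
      have uL: "?u m \<le> real L" for m
      proof -
        have C: "1 \<le> growth \<alpha> m" by (rule growth_ge_1[OF alpha_pos])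
        then have "shift \<le> shift * growth \<alpha> m" using shift_nonneg by (simp add: mult_le_cancel_left1)
        with b[of m] have "real (weight (G m \<omega>) {j}) + shift \<le> (b + shift) * growth \<alpha> m"
          by (simp add: distrib_right)
        then have "?u m \<le> b + shift" using C by (simp add: pos_divide_le_eq)
        with L show ?thesis by simp
      qed
      obtain n0 where n0: "\<And>m. n0 \<le> m \<Longrightarrow> many_vertices m (G m \<omega>) \<and> j \<in> verts (G m \<omega>)"
        using eventually_conj[OF elim(3) eventually_verts[OF elim(3) inv j]]
        unfolding eventually_sequentially by blast
      have "Cauchy ?u"
      proof (rule metric_CauchyI)
        fix e :: real assume "0 < e"
        then have "0 < e / 2" by simp
        then obtain l where l: "1 / real (Suc l) < e / 2" using nat_approx_posE by blast
        obtain n where "\<omega> \<notin> ?E j L l (n + n0)" using elim(1) by blast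
        note notin = this
        have near: "\<bar>?u m - ?u (n + n0)\<bar> < 1 / real (Suc l)" if m: "n + n0 \<le> m" for m
        proof (rule ccontr)
          assume "\<not> \<bar>?u m - ?u (n + n0)\<bar> < 1 / real (Suc l)"
          then have "1 / real (Suc l) \<le> \<bar>?u m - ?u (n + n0)\<bar>" by (simp only: not_less)
          moreover have "\<forall>i\<in>{n + n0..<m}. many_vertices i (G i \<omega>) \<and> j \<in> verts (G i \<omega>)" using n0 by simp
          ultimately show False using notin elim(5) uL[of "n + n0"] m by blast
        qed
        have "dist (?u m) (?u m') < e" if "n + n0 \<le> m" "n + n0 \<le> m'" for m m'
          using near[OF that(1)] near[OF that(2)] l unfolding dist_real_def by linarith
        then show "\<exists>K. \<forall>m\<ge>K. \<forall>m'\<ge>K. dist (?u m) (?u m') < e" by blast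
      qed
      then have "convergent ?u" by (rule Cauchy_convergent)
      then have "convergent (\<lambda>m. ?u m - shift / growth \<alpha> m)"
        using inverse_growth_tendsto_0[OF alpha_pos, of shift]
        by (intro convergent_diff) (auto simp: convergent_def)
      then show "convergent (\<lambda>m. real (weight (G m \<omega>) {j}) / growth \<alpha> m)"
        by (simp add: add_divide_distrib)
    qed
  qed
qed

section \<open>Positivity of the limit for an initial vertex\<close>

text \<open>By the lower bound on the drift,
  \<open>half_product w * sqrt (growth \<alpha> m)\<close> is a supermartingale, and it is large
  whenever the weight \<open>w\<close> is small compared with \<open>growth\<close>. One initial
  vertex suffices for a positive supremum.\<close>

lemma AE_initial_weight_bounded_below:
  "AE \<omega> in M. \<exists>l. \<forall>m. growth \<alpha> m < (real (Suc l))\<^sup>2 * real (weight (G m \<omega>) {0})"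
proof -
  let ?F = "\<lambda>m (g :: wgraph). half_product (weight g {0}) * sqrt (growth \<alpha> m)"
  let ?hit = "\<lambda>l m (g :: wgraph). (real (Suc l))\<^sup>2 * real (weight g {0}) \<le> growth \<alpha> m"
  let ?E = "\<lambda>l. {\<omega> \<in> space M. \<exists>m\<ge>0. ?hit l m (G m \<omega>) \<and> (\<forall>i\<in>{0..<m}. True)}"
  have C: "0 < growth \<alpha> m" for m using growth_pos[OF alpha_pos] .
  have N1: "1 \<le> N" using N by simp
  have zero: "0 \<in> verts g" if inv: "model_inv N m g" for m g
    using model_inv_verts(5)[OF inv N1] N1 by (subst model_inv_verts(1)[OF inv N1]) simp
  have super: "(\<integral>\<^sup>+h. ennreal (?F (Suc m) h) \<partial>step_pmf N p q r g) \<le> ennreal (?F m g)"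
    if inv: "model_inv N m g" for m g
  proof -
    let ?w = "weight g {0}" and ?x = "\<alpha> / (real m + 1)"
    let ?\<phi> = "\<lambda>w. half_product w * sqrt (growth \<alpha> (Suc m))"
    have w: "1 \<le> ?w" by (rule model_inv_weight_ge_1[OF inv zero[OF inv]])
    have x: "0 < ?x" using alpha_pos by simp
    have x1: "?x \<le> 1" using alpha_le_1 by (simp add: divide_le_eq)
    have "?\<phi> ?w + (?\<phi> (?w + 1) - ?\<phi> ?w) * drift m g 0
        = half_product ?w * (1 - drift m g 0 / (2 * real ?w)) * sqrt (growth \<alpha> (Suc m))"
      unfolding half_product_Suc[OF w] by (simp add: algebra_simps)
    also have "\<dots> \<le> half_product ?w * (1 - ?x / 2) * sqrt (growth \<alpha> (Suc m))"
    proof -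
      have "?x / 2 \<le> drift m g 0 / (2 * real ?w)"
        using drift_bounds(1)[of m g 0] w by (simp add: field_simps)
      then show ?thesis
        using half_product_nonneg[of ?w] C[of "Suc m"] by (intro mult_right_mono mult_left_mono) auto
    qed
    also have "\<dots> = half_product ?w * sqrt (growth \<alpha> m) * ((1 - ?x / 2) * sqrt (1 + ?x))"
      by (simp add: growth_Suc real_sqrt_mult)
    also have "\<dots> \<le> half_product ?w * sqrt (growth \<alpha> m) * 1"
    proof (intro mult_left_mono mult_nonneg_nonneg half_product_nonneg)
      \<comment> \<open>The terms of first order cancel, which is why \<open>half_product\<close> is
        paired with the square root of \<open>growth\<close>; the remainder has the right sign
        because \<open>?x \<le> 1\<close>.\<close>
      have "(1 - x / 2)\<^sup>2 * (1 + x) = 1 - x\<^sup>2 * (3 - x) / 4" for x :: real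
        by (simp add: power2_eq_square field_simps)
      then have "(1 - ?x / 2)\<^sup>2 * (1 + ?x) = 1 - ?x\<^sup>2 * (3 - ?x) / 4" .
      also have "\<dots> \<le> 1"
      proof -
        have "0 \<le> ?x\<^sup>2 * (3 - ?x)" by (rule mult_nonneg_nonneg[OF zero_le_power2]) (use x1 in linarith)
        then show ?thesis by simp
      qed
      finally have "sqrt ((1 - ?x / 2)\<^sup>2 * (1 + ?x)) \<le> 1" by simp
      then show "(1 - ?x / 2) * sqrt (1 + ?x) \<le> 1"
        using x x1 by (simp add: real_sqrt_mult)
    qed (use C[of m] in simp)
    finally show ?thesis
      using half_product_nonneg C[of "Suc m"]
      by (intro nn_integral_step_weight_le[OF inv zero[OF inv], of ?\<phi>]) auto
  qed
  have F_hit: "real (Suc l) / 2 \<le> ?F m g" if inv: "model_inv N m g" and hit: "?hit l m g" for l m g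
  proof -
    let ?w = "weight g {0}"
    have w: "1 \<le> ?w" by (rule model_inv_weight_ge_1[OF inv zero[OF inv]])
    \<comment> \<open>The factor \<open>4 * real ?w\<close> is carried along so that
      \<open>half_product_ge\<close> can be inserted, and is then cancelled.\<close>
    have "(real (Suc l) / 2)\<^sup>2 * (4 * real ?w) \<le> growth \<alpha> m * 1"
      using hit by (simp add: power2_eq_square)
    also have "\<dots> \<le> growth \<alpha> m * (4 * real ?w * (half_product ?w)\<^sup>2)"
      using half_product_ge[OF w] C[of m] by (intro mult_left_mono) auto
    finally have "(real (Suc l) / 2)\<^sup>2 * (4 * real ?w) \<le> (half_product ?w)\<^sup>2 * growth \<alpha> m * (4 * real ?w)"
      by (simp only: mult_ac)
    then have "(real (Suc l) / 2)\<^sup>2 \<le> (half_product ?w)\<^sup>2 * growth \<alpha> m"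
      using w by (subst (asm) mult_le_cancel_right_pos) auto
    also have "\<dots> = (?F m g)\<^sup>2" using C[of m] by (simp add: power_mult_distrib)
    finally show ?thesis
      by (rule power2_le_imp_le) (use half_product_nonneg C[of m] in simp)
  qed
  have F_nonneg: "0 \<le> ?F m g" for m g using half_product_nonneg C[of m] by simp
  have F_init: "?F 0 g \<le> 1" for g using half_product_le_1 by simp
  have E: "?E l \<in> events" "prob (?E l) \<le> 1 / (real (Suc l) / 2)" for l
    by (rule maximal_inequality[where F = "\<lambda>_. ?F" and good = "\<lambda>_ _. True" and hit = "\<lambda>_. ?hit l"
        and n = 0 and c = 1 and l = "real (Suc l) / 2", OF F_nonneg super F_init _ _ F_hit events_X]; simp)+
  have "(\<lambda>l. 1 / (real (Suc l) / 2)) \<longlonglongrightarrow> 0" by real_asymp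
  from AE_ex_not_of_prob_tendsto_0[OF E this] AE_space show ?thesis
  proof eventually_elim
    case (elim \<omega>)
    then obtain l where "\<omega> \<notin> ?E l" by blast
    with elim(2) have "\<not> ?hit l m (G m \<omega>)" for m by blast
    then show ?case unfolding not_le by blast
  qed
qed

section \<open>From single weights to the maximum\<close>

lemma AE_limits:
  "AE \<omega> in M. 0 < limit_mu N G \<alpha> \<omega> \<and> limit_mu N G \<alpha> \<omega> < \<infinity> \<and>
    (\<lambda>n. max_weight N G n \<omega>) \<sim>[sequentially]
      (\<lambda>n. 1 / Gamma (1 + \<alpha>) * real_of_ereal (limit_mu N G \<alpha> \<omega>) * real n powr \<alpha>)"
  using AE_weight_convergent AE_late_weights_small AE_initial_weight_bounded_below
proof eventually_elim
  case (elim \<omega>)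
  let ?j0 = "- (int N - 1)"
  define a where "a n j = real (weight (G n \<omega>) {j}) / growth \<alpha> n" for n j
  define A where "A j = lim (\<lambda>n. a n j)" for j
  have C: "0 < growth \<alpha> n" for n by (rule growth_pos[OF alpha_pos])
  have Gamma: "0 < Gamma (1 + \<alpha>)" using alpha_pos by (intro Gamma_real_pos) simp
  have lim: "(\<lambda>n. a n j) \<longlonglongrightarrow> A j" if "?j0 \<le> j" for j
    using elim(1) that unfolding A_def a_def convergent_LIMSEQ_iff by blast
  \<comment> \<open>The factor \<open>Gamma (1 + \<alpha>)\<close> in the definition cancels the
    constant in the asymptotics of \<open>growth\<close>, so both normalisations give the same
    limit.\<close>
  have limit_gamma: "limit_gamma G \<alpha> j \<omega> = A j" if "?j0 \<le> j" for j
  proof -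
    have "(\<lambda>n. a n j * (growth \<alpha> n * real n powr (- \<alpha>))) \<longlonglongrightarrow> A j * (1 / Gamma (1 + \<alpha>))"
      by (intro tendsto_mult lim that growth_asymptotics alpha_pos)
    moreover have "a n j * (growth \<alpha> n * real n powr (- \<alpha>)) = real n powr (- \<alpha>) * vertex_weight G n j \<omega>" for n
      using C[of n] by (simp add: a_def vertex_weight_def)
    ultimately have "lim (\<lambda>n. real n powr (- \<alpha>) * vertex_weight G n j \<omega>) = A j * (1 / Gamma (1 + \<alpha>))"
      by (intro limI) simp
    then show ?thesis unfolding limit_gamma_def using Gamma by simp
  qed
  have j0: "?j0 \<le> 0" using N by simp
  have A0: "0 < A 0"
  proof -
    obtain l where l: "growth \<alpha> n < (real (Suc l))\<^sup>2 * real (weight (G n \<omega>) {0})" for n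
      using elim(3) by blast
    have "1 / (real (Suc l))\<^sup>2 \<le> a n 0" for n
      using l[of n] C[of n] by (simp add: a_def field_simps)
    then have "1 / (real (Suc l))\<^sup>2 \<le> A 0"
      by (intro LIMSEQ_le_const[OF lim[OF j0]]) blast
    moreover have "0 < 1 / (real (Suc l))\<^sup>2" by simp
    ultimately show ?thesis by linarith
  qed
  have tail: "\<exists>J. \<forall>j\<ge>J. \<forall>n. a n j < e" if "0 < e" for e
    using elim(2) that C unfolding a_def by (simp add: pos_divide_less_eq)
  note max = SUP_tendsto_Max[OF lim tail j0 less_imp_le[OF A0]]
  let ?S = "SUP j\<in>{?j0..}. A j"
  have "A 0 \<le> ?S" using max(1) j0 by (intro cSUP_upper) auto
  with A0 have S: "0 < ?S" by linarith
  \<comment> \<open>Boundedness of the limits allows the supremum in the extended reals to be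
    replaced by a real one.\<close>
  have mu: "limit_mu N G \<alpha> \<omega> = ereal ?S"
  proof -
    have "limit_mu N G \<alpha> \<omega> = (SUP j\<in>{?j0..}. ereal (A j))"
      unfolding limit_mu_def using limit_gamma by (intro SUP_cong) auto
    also have "\<dots> = ereal ?S"
    proof (rule antisym)
      show "(SUP j\<in>{?j0..}. ereal (A j)) \<le> ereal ?S"
        using max(1) by (intro SUP_least) (auto intro: cSUP_upper)
      show "ereal ?S \<le> (SUP j\<in>{?j0..}. ereal (A j))"
      proof (rule ereal_le_real)
        fix y assume y: "(SUP j\<in>{?j0..}. ereal (A j)) \<le> ereal y"
        have "A j \<le> y" if "j \<in> {?j0..}" for j
          using order_trans[OF SUP_upper[OF that] y] by simp
        then have "?S \<le> y" by (intro cSUP_least) auto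
        then show "ereal ?S \<le> ereal y" by simp
      qed
    qed
    finally show ?thesis .
  qed
  have max_weight: "max_weight N G n \<omega> = growth \<alpha> n * Max (a n ` {?j0..int n})" for n
  proof -
    have "mono ((*) (growth \<alpha> n))" using C[of n] by (intro monoI mult_left_mono) auto
    then have "growth \<alpha> n * Max (a n ` {?j0..int n}) = Max ((*) (growth \<alpha> n) ` a n ` {?j0..int n})"
      using N by (intro mono_Max_commute) auto
    also have "(*) (growth \<alpha> n) ` a n ` {?j0..int n} = (\<lambda>j. vertex_weight G n j \<omega>) ` {?j0..int n}"
      using C[of n] by (simp add: image_image a_def vertex_weight_def)
    finally show ?thesis by (simp add: max_weight_def)
  qed
  have "(\<lambda>n. max_weight N G n \<omega>) \<sim>[sequentially] (\<lambda>n. 1 / Gamma (1 + \<alpha>) * ?S * real n powr \<alpha>)"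
  proof (rule asymp_equivI')
    have "(\<lambda>n. (growth \<alpha> n * real n powr (- \<alpha>)) * Max (a n ` {?j0..int n}) * (Gamma (1 + \<alpha>) / ?S))
        \<longlonglongrightarrow> 1 / Gamma (1 + \<alpha>) * ?S * (Gamma (1 + \<alpha>) / ?S)"
      by (intro tendsto_mult max(2) growth_asymptotics alpha_pos tendsto_const)
    then show "(\<lambda>n. max_weight N G n \<omega> / (1 / Gamma (1 + \<alpha>) * ?S * real n powr \<alpha>)) \<longlonglongrightarrow> 1"
      using Gamma S by (simp add: max_weight powr_minus field_simps)
  qed
  with S show ?case by (simp add: mu)
qed

text \<open>Each \<open>lim\<close> of measurable real sequences is measurable, and the supremum
  runs over countably many labels.\<close>

lemma limit_mu_measurable: "limit_mu N G \<alpha> \<in> borel_measurable M"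
proof -
  have [measurable]: "(\<lambda>\<omega>. vertex_weight G n j \<omega>) \<in> borel_measurable M" for n j
    unfolding vertex_weight_def by (rule measurable_G_fun)
  have "(\<lambda>\<omega>. limit_gamma G \<alpha> j \<omega>) \<in> borel_measurable M" for j
    unfolding limit_gamma_def by measurable
  then have "(\<lambda>\<omega>. SUP j\<in>{- (int N - 1)..}. ereal (limit_gamma G \<alpha> j \<omega>)) \<in> borel_measurable M"
    by (intro borel_measurable_SUP) auto
  then show ?thesis by (simp add: limit_mu_def[abs_def])
qed

end

theorem theorem2p3:
  fixes M :: "'a measure" and N :: nat and p q r \<alpha> :: real
    and G :: "nat \<Rightarrow> 'a \<Rightarrow> wgraph"
  assumes "N \<ge> 3" and "0 < p" and "p \<le> 1" and "q \<in> {0..1}" and "r \<in> {0..1}"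
    and "interactions_model M N p q r G"
    and "\<alpha> = model_alpha N p q r" and "\<alpha> > 0"
  shows "limit_mu N G \<alpha> \<in> borel_measurable M \<and>
    (AE \<omega> in M. 0 < limit_mu N G \<alpha> \<omega> \<and> limit_mu N G \<alpha> \<omega> < \<infinity>) \<and>
    (AE \<omega> in M. (\<lambda>n. max_weight N G n \<omega>) \<sim>[sequentially]
       (\<lambda>n. 1 / Gamma (1 + \<alpha>) * real_of_ereal (limit_mu N G \<alpha> \<omega>) * real n powr \<alpha>))"
proof -
  interpret prob_space M
    using assms(6) by (simp add: interactions_model_def)
  interpret interactions N p q r M G \<alpha>
    by unfold_locales (use assms in auto)
  show ?thesis
    using limit_mu_measurable AE_limits by auto
qed

end
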